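(* The category $\mathcal{ARS}^{op}$ (the opposite of the category of abstract real spectra) is equivalent to the category $\mathcal{MR}_{red}$ of real reduced multirings.
   Context: An abstract real spectrum (ARS) is a pair $(X,G)$ such that: (AX1) $X$ is a non-empty set, $G$ is a submonoid of $\{-1,0,1\}^X$ (pointwise product) containing the constant functions $-1,0,1$, and $G$ separates points. For $a,b\in G$, $D(a,b)$ is the set of $c\in G$ with, for all $x$: $a(x)c(x)>0$ or $b(x)c(x)>0$ or $c(x)=0$; $D^t(a,b)$ is the set of $c\in G$ with, for all $x$: $a(x)c(x)>0$ or $b(x)c(x)>0$ or ($c(x)=0$ and $b(x)=-a(x)$). (AX2) If $P$ is a submonoid of $G$ with $P\cup-P=G$, $-1\notin P$, $a,b\in P\Rightarrow D(a,b)\subseteq P$, and $ab\in P\cap-P\Rightarrow a\in P\cap-P$ or $b\in P\cap-P$, then there is $x\in X$ with $P=\{a\in G:a(x)\ge0\}$. (AX3) If $p\in D^t(a,q)$ for some $q\in D^t(b,c)$, then $p\in D^t(r,c)$ for some $r\in D^t(a,b)$. A morphism of ARS from $(X,G)$ to $(Y,H)$ is a map $\tau:X\to Y$ with $a\circ\tau\in G$ for each $a\in H$; these form $\mathcal{ARS}$. A multiring is a tuple $(R,+,\cdot,-,0,1)$ with $+:R\times R\to\mathcal P(R)\setminus\{\emptyset\}$ satisfying: $z\in x+y\Rightarrow x\in z+(-y)$ and $y\in(-x)+z$; $y\in0+x\iff y=x$; $+$ associative and commutative; $(R,\cdot,1)$ a commutative monoid; $a0=0$; $c\in a+b\Rightarrow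 cd\in ad+bd$. It is real reduced if $1\ne0$ and $a^3=a$, $c\in a+ab^2\Rightarrow c=a$, $c,d\in a^2+b^2\Rightarrow c=d$ for all $a,b,c,d$. A multiring morphism $f$ satisfies $c\in a+b\Rightarrow f(c)\in f(a)+f(b)$, $f(-a)=-f(a)$, $f(0)=0$, $f(ab)=f(a)f(b)$, $f(1)=1$. $\mathcal{MR}_{red}$ is the category of real reduced multirings with these morphisms. *)

theory Defs
  imports Main "HOL-Library.FuncSet"
begin

text \<open>Elements of G are functions X -> {-1,0,1}; represented as int-valued functions
  on the type 'x that vanish outside X (extensional representation).\<close>

definition sgnfun :: "'x set \<Rightarrow> ('x \<Rightarrow> int) \<Rightarrow> bool" where
  "sgnfun X a \<longleftrightarrow> (\<forall>x\<in>X. a x \<in> {-1, 0, 1}) \<and> (\<forall>x. x \<notin> X \<longrightarrow> a x = 0)"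

definition const_on :: "'x set \<Rightarrow> int \<Rightarrow> 'x \<Rightarrow> int" where
  "const_on X c = (\<lambda>x. if x \<in> X then c else 0)"

definition fprod :: "('x \<Rightarrow> int) \<Rightarrow> ('x \<Rightarrow> int) \<Rightarrow> 'x \<Rightarrow> int" where
  "fprod a b = (\<lambda>x. a x * b x)"

definition fneg :: "('x \<Rightarrow> int) \<Rightarrow> 'x \<Rightarrow> int" where
  "fneg a = (\<lambda>x. - a x)"

definition Dset :: "'x set \<Rightarrow> ('x \<Rightarrow> int) set \<Rightarrow> ('x \<Rightarrow> int) \<Rightarrow> ('x \<Rightarrow> int) \<Rightarrow> ('x \<Rightarrow> int) set" where
  "Dset X G a b = {c \<in> G. \<forall>x\<in>X. a x * c x > 0 \<or> b x * c x > 0 \<or> c x = 0}"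

definition Dtset :: "'x set \<Rightarrow> ('x \<Rightarrow> int) set \<Rightarrow> ('x \<Rightarrow> int) \<Rightarrow> ('x \<Rightarrow> int) \<Rightarrow> ('x \<Rightarrow> int) set" where
  "Dtset X G a b = {c \<in> G. \<forall>x\<in>X. a x * c x > 0 \<or> b x * c x > 0 \<or> (c x = 0 \<and> b x = - a x)}"

definition ARS :: "'x set \<Rightarrow> ('x \<Rightarrow> int) set \<Rightarrow> bool" where
  "ARS X G \<longleftrightarrow>
     \<comment> \<open>AX1\<close>
     X \<noteq> {} \<and> (\<forall>a\<in>G. sgnfun X a) \<and> (\<forall>a\<in>G. \<forall>b\<in>G. fprod a b \<in> G) \<and>
     const_on X (-1) \<in> G \<and> const_on X 0 \<in> G \<and> const_on X 1 \<in> G \<and>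
     (\<forall>x\<in>X. \<forall>y\<in>X. x \<noteq> y \<longrightarrow> (\<exists>a\<in>G. a x \<noteq> a y)) \<and>
     \<comment> \<open>AX2\<close>
     (\<forall>P. P \<subseteq> G \<and> const_on X 1 \<in> P \<and> (\<forall>a\<in>P. \<forall>b\<in>P. fprod a b \<in> P) \<and>
          P \<union> fneg ` P = G \<and> const_on X (-1) \<notin> P \<and>
          (\<forall>a\<in>P. \<forall>b\<in>P. Dset X G a b \<subseteq> P) \<and>
          (\<forall>a\<in>G. \<forall>b\<in>G. fprod a b \<in> P \<inter> fneg ` P \<longrightarrow> a \<in> P \<inter> fneg ` P \<or> b \<in> P \<inter> fneg ` P)
        \<longrightarrow> (\<exists>x\<in>X. P = {a \<in> G. a x \<ge> 0})) \<and>
     \<comment> \<open>AX3\<close>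
     (\<forall>a\<in>G. \<forall>b\<in>G. \<forall>c\<in>G. \<forall>p\<in>G.
        (\<exists>q\<in>Dtset X G b c. p \<in> Dtset X G a q) \<longrightarrow> (\<exists>r\<in>Dtset X G a b. p \<in> Dtset X G r c))"

definition pull :: "'x set \<Rightarrow> ('x \<Rightarrow> 'y) \<Rightarrow> ('y \<Rightarrow> int) \<Rightarrow> 'x \<Rightarrow> int" where
  "pull X \<tau> a = (\<lambda>x. if x \<in> X then a (\<tau> x) else 0)"

definition ars_hom :: "'x set \<Rightarrow> ('x \<Rightarrow> int) set \<Rightarrow> 'y set \<Rightarrow> ('y \<Rightarrow> int) set \<Rightarrow> ('x \<Rightarrow> 'y) \<Rightarrow> bool" where
  "ars_hom X G Y H \<tau> \<longleftrightarrow> \<tau> \<in> X \<rightarrow>\<^sub>E Y \<and> (\<forall>a\<in>H. pull X \<tau> a \<in> G)"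

definition ars_iso :: "'x set \<Rightarrow> ('x \<Rightarrow> int) set \<Rightarrow> 'y set \<Rightarrow> ('y \<Rightarrow> int) set \<Rightarrow> ('x \<Rightarrow> 'y) \<Rightarrow> bool" where
  "ars_iso X G Y H \<tau> \<longleftrightarrow> ars_hom X G Y H \<tau> \<and>
     (\<exists>\<psi>. ars_hom Y H X G \<psi> \<and> compose X \<psi> \<tau> = restrict id X \<and> compose Y \<tau> \<psi> = restrict id Y)"

record 'a mring =
  mcar :: "'a set"
  madd :: "'a \<Rightarrow> 'a \<Rightarrow> 'a set"
  mmul :: "'a \<Rightarrow> 'a \<Rightarrow> 'a"
  mneg :: "'a \<Rightarrow> 'a"
  mzero :: "'a"
  mone :: "'a"

definition multiring :: "'a mring \<Rightarrow> bool" where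
  "multiring R \<longleftrightarrow>
     mzero R \<in> mcar R \<and> mone R \<in> mcar R \<and>
     (\<forall>a\<in>mcar R. mneg R a \<in> mcar R) \<and>
     (\<forall>a\<in>mcar R. \<forall>b\<in>mcar R. mmul R a b \<in> mcar R) \<and>
     (\<forall>a\<in>mcar R. \<forall>b\<in>mcar R. madd R a b \<subseteq> mcar R \<and> madd R a b \<noteq> {}) \<and>
     (\<forall>x\<in>mcar R. \<forall>y\<in>mcar R. \<forall>z\<in>mcar R. z \<in> madd R x y \<longrightarrow>
         x \<in> madd R z (mneg R y) \<and> y \<in> madd R (mneg R x) z) \<and>
     (\<forall>x\<in>mcar R. \<forall>y\<in>mcar R. y \<in> madd R (mzero R) x \<longleftrightarrow> y = x) \<and>
     (\<forall>a\<in>mcar R. \<forall>b\<in>mcar R. \<forall>c\<in>mcar R.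
         (\<Union>w\<in>madd R a b. madd R w c) = (\<Union>w\<in>madd R b c. madd R a w)) \<and>
     (\<forall>a\<in>mcar R. \<forall>b\<in>mcar R. madd R a b = madd R b a) \<and>
     (\<forall>a\<in>mcar R. \<forall>b\<in>mcar R. \<forall>c\<in>mcar R. mmul R (mmul R a b) c = mmul R a (mmul R b c)) \<and>
     (\<forall>a\<in>mcar R. \<forall>b\<in>mcar R. mmul R a b = mmul R b a) \<and>
     (\<forall>a\<in>mcar R. mmul R (mone R) a = a) \<and>
     (\<forall>a\<in>mcar R. mmul R a (mzero R) = mzero R) \<and>
     (\<forall>a\<in>mcar R. \<forall>b\<in>mcar R. \<forall>c\<in>mcar R. \<forall>d\<in>mcar R. c \<in> madd R a b \<longrightarrow>
         mmul R c d \<in> madd R (mmul R a d) (mmul R b d))"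

definition real_reduced :: "'a mring \<Rightarrow> bool" where
  "real_reduced R \<longleftrightarrow> multiring R \<and> mone R \<noteq> mzero R \<and>
     (\<forall>a\<in>mcar R. mmul R (mmul R a a) a = a) \<and>
     (\<forall>a\<in>mcar R. \<forall>b\<in>mcar R. \<forall>c\<in>mcar R.
         c \<in> madd R a (mmul R a (mmul R b b)) \<longrightarrow> c = a) \<and>
     (\<forall>a\<in>mcar R. \<forall>b\<in>mcar R. \<forall>c\<in>mcar R. \<forall>d\<in>mcar R.
         c \<in> madd R (mmul R a a) (mmul R b b) \<and> d \<in> madd R (mmul R a a) (mmul R b b) \<longrightarrow> c = d)"

definition mr_hom :: "'a mring \<Rightarrow> 'b mring \<Rightarrow> ('a \<Rightarrow> 'b) \<Rightarrow> bool" where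
  "mr_hom R S f \<longleftrightarrow> f \<in> mcar R \<rightarrow>\<^sub>E mcar S \<and>
     (\<forall>a\<in>mcar R. \<forall>b\<in>mcar R. \<forall>c\<in>mcar R. c \<in> madd R a b \<longrightarrow> f c \<in> madd S (f a) (f b)) \<and>
     (\<forall>a\<in>mcar R. f (mneg R a) = mneg S (f a)) \<and>
     f (mzero R) = mzero S \<and>
     (\<forall>a\<in>mcar R. \<forall>b\<in>mcar R. f (mmul R a b) = mmul S (f a) (f b)) \<and>
     f (mone R) = mone S"

definition mr_iso :: "'a mring \<Rightarrow> 'b mring \<Rightarrow> ('a \<Rightarrow> 'b) \<Rightarrow> bool" where
  "mr_iso R S f \<longleftrightarrow> mr_hom R S f \<and>
     (\<exists>g. mr_hom S R g \<and> compose (mcar R) g f = restrict id (mcar R) \<and>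
          compose (mcar S) f g = restrict id (mcar S))"

definition Q2 :: "int mring" where
  "Q2 = \<lparr> mcar = {-1, 0, 1},
          madd = (\<lambda>a b. {c \<in> {-1, 0, 1}. a * c > 0 \<or> b * c > 0 \<or> (c = 0 \<and> b = - a)}),
          mmul = (*), mneg = uminus, mzero = 0, mone = 1 \<rparr>"

definition mr_of_ARS :: "'x set \<Rightarrow> ('x \<Rightarrow> int) set \<Rightarrow> ('x \<Rightarrow> int) mring" where
  "mr_of_ARS X G = \<lparr> mcar = G, madd = Dtset X G, mmul = fprod, mneg = fneg,
                     mzero = const_on X 0, mone = const_on X 1 \<rparr>"

definition mr_map :: "'x set \<Rightarrow> ('y \<Rightarrow> int) set \<Rightarrow> ('x \<Rightarrow> 'y) \<Rightarrow> ('y \<Rightarrow> int) \<Rightarrow> ('x \<Rightarrow> int)" where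
  "mr_map X H \<tau> = restrict (pull X \<tau>) H"

text \<open>Multiring R |-> ARS of its orderings (morphisms R -> Q2) with the functions a-hat.\<close>
definition ARS_pts :: "'a mring \<Rightarrow> ('a \<Rightarrow> int) set" where
  "ARS_pts R = {\<sigma>. mr_hom R Q2 \<sigma>}"

definition hatf :: "'a mring \<Rightarrow> 'a \<Rightarrow> ('a \<Rightarrow> int) \<Rightarrow> int" where
  "hatf R a = (\<lambda>\<sigma>. if \<sigma> \<in> ARS_pts R then \<sigma> a else 0)"

definition ARS_fns :: "'a mring \<Rightarrow> (('a \<Rightarrow> int) \<Rightarrow> int) set" where
  "ARS_fns R = hatf R ` mcar R"

definition ars_map :: "'a mring \<Rightarrow> 'b mring \<Rightarrow> ('a \<Rightarrow> 'b) \<Rightarrow> ('b \<Rightarrow> int) \<Rightarrow> ('a \<Rightarrow> int)" where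
  "ars_map R S f = restrict (\<lambda>\<sigma>. compose (mcar R) \<sigma> f) (ARS_pts S)"

definition ars_unit :: "'x set \<Rightarrow> ('x \<Rightarrow> int) set \<Rightarrow> 'x \<Rightarrow> (('x \<Rightarrow> int) \<Rightarrow> int)" where
  "ars_unit X G = restrict (\<lambda>x. restrict (\<lambda>a. a x) G) X"

definition mr_unit :: "'a mring \<Rightarrow> 'a \<Rightarrow> (('a \<Rightarrow> int) \<Rightarrow> int)" where
  "mr_unit R = restrict (hatf R) (mcar R)"

end

theory Submission
  imports Defs
begin

text \<open>
  Everything except one point is checked pointwise in \<open>Q2\<close>. That point is the representation
  theorem: in a real reduced multiring, \<open>c \<in> a + b\<close> as soon as \<open>\<sigma> c \<in> \<sigma> a + \<sigma> b\<close> for every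
  morphism \<open>\<sigma>\<close> to \<open>Q2\<close>.

  Put \<open>e = c\<^sup>2\<close>, \<open>u = ac\<close>, \<open>v = bc\<close>. If no \<open>\<sigma>\<close> has \<open>\<sigma> c \<noteq> 0\<close> and \<open>\<sigma> u, \<sigma> v \<le> 0\<close>, then by Zorn's lemma
  \<open>-e\<close> lies in the preordering generated by \<open>-u\<close> and \<open>-v\<close>. Since \<open>x + xs\<^sup>2 = {x}\<close>, the coefficients can
  be normalised, giving \<open>0 \<in> e - u - v + uv\<close>, that is, some \<open>w \<in> (u + v) \<inter> (e + uv)\<close>. Then
  \<open>w\<^sup>2 \<in> u + v\<close>. The support of the quadratic module generated by \<open>-u\<close> and \<open>-v\<close> is an ideal; it contains
  \<open>w\<close>, hence \<open>u\<close>, hence \<open>e\<close>. Normalising again gives \<open>e \<in> u + v\<close>, so \<open>c \<in> c\<^sup>2a + c\<^sup>2b\<close>. Adding this to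
  the analogous statements for \<open>a \<in> c - b\<close> and \<open>b \<in> c - a\<close> and absorbing squares yields \<open>c \<in> a + b\<close>.
\<close>

section \<open>Signs encoded by two membership conditions\<close>

definition sgn_of :: "bool \<Rightarrow> bool \<Rightarrow> int" where
  "sgn_of p n = (if p then if n then 0 else 1 else -1)"

lemma sgn_of_simps: "sgn_of True True = 0" "sgn_of True False = 1" "sgn_of False n = -1"
  by (simp_all add: sgn_of_def)

lemma madd_Q2: "c \<in> madd Q2 a b \<longleftrightarrow> c \<in> {-1, 0, 1} \<and> (a * c > 0 \<or> b * c > 0 \<or> c = 0 \<and> b = - a)"
  by (simp add: Q2_def)

text \<open>Unprimed and primed letters record whether an element and its negative lie in an
  ordering. The first three hypotheses are totality, so the default -1 of \<open>sgn_of\<close> for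
  two false arguments never occurs. The other six are closure under addition for the rearrangements
  of \<open>c \<in> a + b\<close> and their negatives. What remains is a finite check.\<close>

lemma sgn_of_add:
  assumes "A \<or> A'" "B \<or> B'" "D \<or> D'" "A \<and> B \<longrightarrow> D" "D \<and> B' \<longrightarrow> A" "D \<and> A' \<longrightarrow> B"
    "A' \<and> B' \<longrightarrow> D'" "D' \<and> B \<longrightarrow> A'" "D' \<and> A \<longrightarrow> B'"
  shows "sgn_of D D' \<in> madd Q2 (sgn_of A A') (sgn_of B B')"
  by (insert assms, (cases A; cases A'; cases B; cases B'; cases D; cases D'))
    (simp_all add: madd_Q2 sgn_of_simps)

text \<open>The last hypothesis is primeness of the support; it excludes a product of sign 0 with
  two factors of nonzero sign.\<close>

lemma sgn_of_mult:
  assumes "A \<or> A'" "B \<or> B'" "A \<and> B \<or> A' \<and> B' \<longrightarrow> D" "A \<and> B' \<or> A' \<and> B \<longrightarrow> D'"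
    "D \<and> D' \<longrightarrow> A \<and> A' \<or> B \<and> B'"
  shows "sgn_of D D' = sgn_of A A' * sgn_of B B'"
  by (insert assms, (cases A; cases A'; cases B; cases B'; cases D; cases D'))
    (simp_all add: sgn_of_simps)

section \<open>Sum sets in a real reduced multiring\<close>

locale real_reduced_multiring =
  fixes R :: "'a mring"
  assumes real_reduced: "real_reduced R"
begin

abbreviation C :: "'a set" where "C \<equiv> mcar R"
abbreviation mult :: "'a \<Rightarrow> 'a \<Rightarrow> 'a" (infixl "\<cdot>" 70) where "a \<cdot> b \<equiv> mmul R a b"
abbreviation neg :: "'a \<Rightarrow> 'a" ("\<ominus> _" [80] 80) where "\<ominus> a \<equiv> mneg R a"
abbreviation zero :: 'a ("\<zero>") where "\<zero> \<equiv> mzero R"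
abbreviation one :: 'a ("\<one>") where "\<one> \<equiv> mone R"

text \<open>Lifted to sets, the hyperaddition is an ordinary associative and commutative operation,
  so sums can be rearranged by rewriting. Intersecting with the carrier makes both laws hold for
  arbitrary sets.\<close>

definition ssum :: "'a set \<Rightarrow> 'a set \<Rightarrow> 'a set" (infixl "\<oplus>" 65) where
  "A \<oplus> B = (\<Union>a\<in>A \<inter> C. \<Union>b\<in>B \<inter> C. madd R a b)"

lemma multiring: "multiring R"
  using real_reduced by (simp add: real_reduced_def)

lemma multiring_axioms:
  shows madd_carrier: "\<forall>a\<in>C. \<forall>b\<in>C. madd R a b \<subseteq> C \<and> madd R a b \<noteq> {}"
    and madd_reverse: "\<forall>x\<in>C. \<forall>y\<in>C. \<forall>z\<in>C. z \<in> madd R x y \<longrightarrow>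
          x \<in> madd R z (\<ominus> y) \<and> y \<in> madd R (\<ominus> x) z"
    and madd_zero: "\<forall>x\<in>C. \<forall>y\<in>C. y \<in> madd R \<zero> x \<longleftrightarrow> y = x"
    and madd_assoc: "\<forall>a\<in>C. \<forall>b\<in>C. \<forall>c\<in>C.
          (\<Union>w\<in>madd R a b. madd R w c) = (\<Union>w\<in>madd R b c. madd R a w)"
    and madd_commute: "\<forall>a\<in>C. \<forall>b\<in>C. madd R a b = madd R b a"
    and mmul_assoc: "\<forall>a\<in>C. \<forall>b\<in>C. \<forall>c\<in>C. a \<cdot> b \<cdot> c = a \<cdot> (b \<cdot> c)"
    and mmul_commute: "\<forall>a\<in>C. \<forall>b\<in>C. a \<cdot> b = b \<cdot> a"
    and mmul_one: "\<forall>a\<in>C. \<one> \<cdot> a = a"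
    and mmul_zero: "\<forall>a\<in>C. a \<cdot> \<zero> = \<zero>"
    and mmul_madd: "\<forall>a\<in>C. \<forall>b\<in>C. \<forall>c\<in>C. \<forall>d\<in>C. c \<in> madd R a b \<longrightarrow>
          c \<cdot> d \<in> madd R (a \<cdot> d) (b \<cdot> d)"
    and zero_closed [simp]: "\<zero> \<in> C"
    and one_closed [simp]: "\<one> \<in> C"
    and mneg_carrier: "\<forall>a\<in>C. \<ominus> a \<in> C"
    and mmul_carrier: "\<forall>a\<in>C. \<forall>b\<in>C. a \<cdot> b \<in> C"
  by (insert multiring[unfolded multiring_def], (elim conjE, assumption)+)

lemma neg_closed [simp]: "a \<in> C \<Longrightarrow> \<ominus> a \<in> C"
  and mult_closed [simp]: "a \<in> C \<Longrightarrow> b \<in> C \<Longrightarrow> a \<cdot> b \<in> C"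
  using mneg_carrier mmul_carrier by blast+

lemma madd_closed: "a \<in> C \<Longrightarrow> b \<in> C \<Longrightarrow> x \<in> madd R a b \<Longrightarrow> x \<in> C"
  and madd_nonempty: "a \<in> C \<Longrightarrow> b \<in> C \<Longrightarrow> madd R a b \<noteq> {}"
  using madd_carrier by blast+

lemma mult_assoc: "a \<in> C \<Longrightarrow> b \<in> C \<Longrightarrow> c \<in> C \<Longrightarrow> a \<cdot> b \<cdot> c = a \<cdot> (b \<cdot> c)"
  using mmul_assoc by blast

lemma mult_commute: "a \<in> C \<Longrightarrow> b \<in> C \<Longrightarrow> a \<cdot> b = b \<cdot> a"
  using mmul_commute by blast

lemma one_mult [simp]: "a \<in> C \<Longrightarrow> \<one> \<cdot> a = a"
  and mult_zero [simp]: "a \<in> C \<Longrightarrow> a \<cdot> \<zero> = \<zero>"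
  using mmul_one mmul_zero by blast+

lemma mult_left_commute: "a \<in> C \<Longrightarrow> b \<in> C \<Longrightarrow> c \<in> C \<Longrightarrow> a \<cdot> (b \<cdot> c) = b \<cdot> (a \<cdot> c)"
  by (metis mult_assoc mult_commute)

lemmas mult_ac = mult_assoc mult_commute mult_left_commute

lemma mult_one [simp]: "a \<in> C \<Longrightarrow> a \<cdot> \<one> = a"
  and zero_mult [simp]: "a \<in> C \<Longrightarrow> \<zero> \<cdot> a = \<zero>"
  using mult_commute[of a \<one>] mult_commute[of \<zero> a] by simp_all

lemma reduced_axioms:
  shows one_neq_zero: "\<one> \<noteq> \<zero>"
    and cube_eq: "\<forall>a\<in>C. a \<cdot> a \<cdot> a = a"
    and madd_absorb: "\<forall>a\<in>C. \<forall>b\<in>C. \<forall>c\<in>C. c \<in> madd R a (a \<cdot> (b \<cdot> b)) \<longrightarrow> c = a"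
  by (insert real_reduced[unfolded real_reduced_def], (elim conjE, assumption)+)

lemma cube [simp]: "a \<in> C \<Longrightarrow> a \<cdot> (a \<cdot> a) = a"
  using cube_eq mult_assoc by simp

lemma cube_left [simp]: "a \<in> C \<Longrightarrow> b \<in> C \<Longrightarrow> a \<cdot> (a \<cdot> (a \<cdot> b)) = a \<cdot> b"
  by (metis cube mult_assoc mult_closed)

lemma ssum_singles: "a \<in> C \<Longrightarrow> b \<in> C \<Longrightarrow> {a} \<oplus> {b} = madd R a b"
  by (simp add: ssum_def)

lemma ssum_subset: "A \<oplus> B \<subseteq> C"
  by (auto simp: ssum_def intro: madd_closed)

lemma ssumD: "x \<in> A \<oplus> B \<Longrightarrow> x \<in> C"
  using ssum_subset by blast

lemma ssumE:
  assumes "x \<in> A \<oplus> B"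
  obtains a b where "a \<in> A" "b \<in> B" "a \<in> C" "b \<in> C" "x \<in> {a} \<oplus> {b}"
  using assms by (auto simp: ssum_def)

lemma ssum_mono: "A \<subseteq> A' \<Longrightarrow> B \<subseteq> B' \<Longrightarrow> A \<oplus> B \<subseteq> A' \<oplus> B'"
  by (auto simp: ssum_def)

lemma ssumI: "x \<in> {a} \<oplus> {b} \<Longrightarrow> a \<in> A \<Longrightarrow> b \<in> B \<Longrightarrow> x \<in> A \<oplus> B"
  using ssum_mono[of "{a}" A "{b}" B] by blast

lemma ssum_commute: "A \<oplus> B = B \<oplus> A"
proof -
  have "A \<oplus> B \<subseteq> B \<oplus> A" for A B
    unfolding ssum_def using madd_commute by blast
  then show ?thesis by blast
qed

lemma ssum_assoc: "A \<oplus> B \<oplus> D = A \<oplus> (B \<oplus> D)"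
proof -
  have assoc: "{a} \<oplus> {b} \<oplus> {d} = {a} \<oplus> ({b} \<oplus> {d})" if abd: "a \<in> C" "b \<in> C" "d \<in> C" for a b d
  proof -
    have "madd R a b \<inter> C = madd R a b" "madd R b d \<inter> C = madd R b d"
      using madd_closed abd by blast+
    then show ?thesis
      using madd_assoc[rule_format, OF abd] abd by (simp add: ssum_singles) (simp add: ssum_def)
  qed
  show ?thesis
  proof (intro equalityI subsetI)
    fix x assume "x \<in> A \<oplus> B \<oplus> D"
    then obtain w d where w: "w \<in> A \<oplus> B" "d \<in> D" "d \<in> C" "x \<in> {w} \<oplus> {d}" by (rule ssumE)
    then obtain a b where ab: "a \<in> A" "b \<in> B" "a \<in> C" "b \<in> C" "w \<in> {a} \<oplus> {b}" by (auto elim: ssumE)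
    have "x \<in> {a} \<oplus> {b} \<oplus> {d}" using w(4) ab(5) by (rule ssumI) simp
    then have "x \<in> {a} \<oplus> ({b} \<oplus> {d})" using assoc ab w by simp
    then show "x \<in> A \<oplus> (B \<oplus> D)"
      using ssum_mono[of "{a}" A "{b} \<oplus> {d}" "B \<oplus> D"] ssum_mono[of "{b}" B "{d}" D] ab w by blast
  next
    fix x assume "x \<in> A \<oplus> (B \<oplus> D)"
    then obtain a w where w: "a \<in> A" "w \<in> B \<oplus> D" "a \<in> C" "x \<in> {a} \<oplus> {w}" by (rule ssumE)
    then obtain b d where bd: "b \<in> B" "d \<in> D" "b \<in> C" "d \<in> C" "w \<in> {b} \<oplus> {d}" by (auto elim: ssumE)
    have "x \<in> {a} \<oplus> ({b} \<oplus> {d})" using w(4) _ bd(5) by (rule ssumI) simp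
    then have "x \<in> {a} \<oplus> {b} \<oplus> {d}" using assoc bd w by simp
    then show "x \<in> A \<oplus> B \<oplus> D"
      using ssum_mono[of "{a} \<oplus> {b}" "A \<oplus> B" "{d}" D] ssum_mono[of "{a}" A "{b}" B] bd w by blast
  qed
qed

lemma ssum_left_commute: "A \<oplus> (B \<oplus> D) = B \<oplus> (A \<oplus> D)"
  by (metis ssum_assoc ssum_commute)

lemmas ssum_ac = ssum_assoc ssum_commute ssum_left_commute

lemma zero_ssum: "a \<in> C \<Longrightarrow> {\<zero>} \<oplus> {a} = {a}"
proof -
  assume a: "a \<in> C"
  have "y \<in> madd R \<zero> a \<longleftrightarrow> y = a" if "y \<in> C" for y
    using madd_zero a that by blast
  then show ?thesis
    using a madd_closed[OF zero_closed a] by (auto simp: ssum_singles)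
qed

lemma zero_ssum_set: "Y \<subseteq> C \<Longrightarrow> {\<zero>} \<oplus> Y = Y"
proof -
  assume "Y \<subseteq> C"
  have "{\<zero>} \<oplus> Y = (\<Union>y\<in>Y \<inter> C. {\<zero>} \<oplus> {y})" by (auto simp: ssum_def)
  also have "\<dots> = (\<Union>y\<in>Y. {y})" using zero_ssum \<open>Y \<subseteq> C\<close> by blast
  finally show ?thesis by simp
qed

lemma zero_in_ssum: "\<zero> \<in> A \<Longrightarrow> B \<subseteq> C \<Longrightarrow> B \<subseteq> A \<oplus> B"
  using zero_ssum ssumI by blast

lemma ssum_nonempty: "a \<in> C \<Longrightarrow> b \<in> C \<Longrightarrow> \<exists>x. x \<in> {a} \<oplus> {b}"
  using madd_nonempty by (auto simp: ssum_singles)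

lemma ssum_rev: "z \<in> {x} \<oplus> {y} \<Longrightarrow> x \<in> C \<Longrightarrow> y \<in> C \<Longrightarrow> x \<in> {z} \<oplus> {\<ominus> y}"
  using madd_reverse ssumD[of z "{x}" "{y}"] by (simp add: ssum_singles)

lemma neg_unique: "a \<in> C \<Longrightarrow> b \<in> C \<Longrightarrow> \<zero> \<in> {a} \<oplus> {b} \<Longrightarrow> a = \<ominus> b"
  using ssum_rev[of \<zero> a b] zero_ssum by auto

lemma zero_in_diff: "a \<in> C \<Longrightarrow> \<zero> \<in> {a} \<oplus> {\<ominus> a}"
  using ssum_rev[of a \<zero> a] zero_ssum by simp

lemma neg_neg [simp]: "a \<in> C \<Longrightarrow> \<ominus> \<ominus> a = a"
  using neg_unique[of a "\<ominus> a"] zero_in_diff by simp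

lemma neg_zero [simp]: "\<ominus> \<zero> = \<zero>"
  using neg_unique[of \<zero> \<zero>] zero_ssum by simp

lemma ssum_rev': "z \<in> {x} \<oplus> {\<ominus> y} \<Longrightarrow> x \<in> C \<Longrightarrow> y \<in> C \<Longrightarrow> x \<in> {z} \<oplus> {y}"
  using ssum_rev[of z x "\<ominus> y"] by simp

lemma mult_ssum1: "x \<in> {a} \<oplus> {b} \<Longrightarrow> a \<in> C \<Longrightarrow> b \<in> C \<Longrightarrow> d \<in> C \<Longrightarrow> x \<cdot> d \<in> {a \<cdot> d} \<oplus> {b \<cdot> d}"
  using mmul_madd ssumD[of x "{a}" "{b}"] by (simp add: ssum_singles)

lemma mult_ssum:
  assumes "x \<in> A \<oplus> B" "d \<in> C"
    and "\<And>a. a \<in> A \<Longrightarrow> a \<in> C \<Longrightarrow> a \<cdot> d \<in> A'" "\<And>b. b \<in> B \<Longrightarrow> b \<in> C \<Longrightarrow> b \<cdot> d \<in> B'"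
  shows "x \<cdot> d \<in> A' \<oplus> B'"
proof -
  obtain a b where ab: "a \<in> A" "b \<in> B" "a \<in> C" "b \<in> C" "x \<in> {a} \<oplus> {b}"
    using assms(1) by (rule ssumE)
  show ?thesis
    using mult_ssum1[OF ab(5,3,4) assms(2)] assms(3)[OF ab(1,3)] assms(4)[OF ab(2,4)] by (rule ssumI)
qed

lemma neg_mult [simp]: "a \<in> C \<Longrightarrow> b \<in> C \<Longrightarrow> \<ominus> a \<cdot> b = \<ominus> (a \<cdot> b)"
  using neg_unique[of "\<ominus> a \<cdot> b" "a \<cdot> b"] mult_ssum1[OF zero_in_diff[of a], of b]
  by (simp add: ssum_commute)

lemma mult_neg [simp]: "a \<in> C \<Longrightarrow> b \<in> C \<Longrightarrow> a \<cdot> \<ominus> b = \<ominus> (a \<cdot> b)"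
  using neg_mult[of b a] by (simp add: mult_commute)

lemma neg_ssum: "x \<in> {a} \<oplus> {b} \<Longrightarrow> a \<in> C \<Longrightarrow> b \<in> C \<Longrightarrow> \<ominus> x \<in> {\<ominus> a} \<oplus> {\<ominus> b}"
  using mult_ssum1[of x a b "\<ominus> \<one>"] ssumD[of x "{a}" "{b}"] by simp

section \<open>Squares and their absorption\<close>

definition Sq :: "'a set" where "Sq = (\<lambda>a. a \<cdot> a) ` C"

lemma Sq_closed: "s \<in> Sq \<Longrightarrow> s \<in> C"
  by (auto simp: Sq_def)

lemma square_in_Sq [simp]: "a \<in> C \<Longrightarrow> a \<cdot> a \<in> Sq"
  by (auto simp: Sq_def)

lemma Sq_idem: "s \<in> Sq \<Longrightarrow> s \<cdot> s = s"
  by (auto simp: Sq_def mult_assoc)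

lemma Sq_mult: "s \<in> Sq \<Longrightarrow> t \<in> Sq \<Longrightarrow> s \<cdot> t \<in> Sq"
proof -
  assume "s \<in> Sq" "t \<in> Sq"
  then obtain a b where "a \<in> C" "b \<in> C" "s = a \<cdot> a" "t = b \<cdot> b" by (auto simp: Sq_def)
  moreover from this have "s \<cdot> t = (a \<cdot> b) \<cdot> (a \<cdot> b)" by (simp add: mult_ac)
  ultimately show ?thesis by simp
qed

lemma one_in_Sq: "\<one> \<in> Sq" and zero_in_Sq: "\<zero> \<in> Sq"
  using square_in_Sq[of \<one>] square_in_Sq[of \<zero>] by simp_all

text \<open>The axiom says that no element other than \<open>a\<close> lies in the sum; nonemptiness
  of hypersums turns this into an equality of sets.\<close>

lemma absorb:
  assumes "a \<in> C" "s \<in> Sq" shows "{a} \<oplus> {a \<cdot> s} = {a}"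
proof -
  obtain b where b: "b \<in> C" "s = b \<cdot> b" using assms by (auto simp: Sq_def)
  have "x = a" if "x \<in> {a} \<oplus> {a \<cdot> s}" for x
    using madd_absorb assms(1) b that ssumD[OF that] by (simp add: ssum_singles)
  moreover obtain x where "x \<in> {a} \<oplus> {a \<cdot> s}"
    using ssum_nonempty[of a "a \<cdot> s"] assms Sq_closed by auto
  ultimately show ?thesis by blast
qed

lemma absorb_self: "a \<in> C \<Longrightarrow> {a} \<oplus> {a} = {a}"
  using absorb[of a \<one>] one_in_Sq by simp

lemma absorb_left: "a \<in> C \<Longrightarrow> s \<in> Sq \<Longrightarrow> {a} \<oplus> ({a \<cdot> s} \<oplus> B) = {a} \<oplus> B"
  by (simp add: absorb flip: ssum_assoc)

text \<open>The square is \<open>p\<^sup>2\<close> for any \<open>p \<in> 1 + x\<close>: then \<open>p\<^sup>2 \<in> 1 + x + x + x\<^sup>2 = 1 + x\<close>. This makes the support of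
  a quadratic module an ideal.\<close>

lemma diff_of_squares:
  assumes x: "x \<in> C" obtains s where "s \<in> Sq" "x \<in> {s} \<oplus> {\<ominus> \<one>}"
proof -
  obtain p where p: "p \<in> {\<one>} \<oplus> {x}" using ssum_nonempty[OF one_closed x] by blast
  have pc: "p \<in> C" using p ssumD by blast
  have px: "p \<cdot> x \<in> {x} \<oplus> {x \<cdot> x}" using mult_ssum1[OF p _ x x] x by simp
  have "p \<cdot> p \<in> {p} \<oplus> {p \<cdot> x}" using mult_ssum1[OF p _ x pc] x pc by (simp add: mult_commute)
  then have "p \<cdot> p \<in> ({\<one>} \<oplus> {x}) \<oplus> ({x} \<oplus> {x \<cdot> x})" using p px by (rule ssumI)
  also have "\<dots> = ({\<one>} \<oplus> {\<one> \<cdot> (x \<cdot> x)}) \<oplus> ({x} \<oplus> {x})" using x by (simp add: ssum_ac)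
  also have "\<dots> = {x} \<oplus> {\<one>}" using x by (simp only: absorb absorb_self square_in_Sq one_closed ssum_commute)
  finally show ?thesis using that[of "p \<cdot> p"] ssum_rev[of "p \<cdot> p" x \<one>] x pc by simp
qed

section \<open>Quadratic modules, preorderings and orderings\<close>

text \<open>The union of all finite hypersums of members of \<open>A\<close>. Adding one generator
  at a time reduces closure under sums and products to generators by induction.\<close>

inductive_set asum :: "'a set \<Rightarrow> 'a set" for A where
  asum_zero: "\<zero> \<in> asum A"
| asum_add: "x \<in> asum A \<Longrightarrow> a \<in> A \<Longrightarrow> y \<in> {x} \<oplus> {a} \<Longrightarrow> y \<in> asum A"

lemma asum_subset: "asum A \<subseteq> C"
proof
  fix x assume "x \<in> asum A" then show "x \<in> C" by cases (auto dest: ssumD)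
qed

lemma asum_incl: "A \<subseteq> C \<Longrightarrow> A \<subseteq> asum A"
  using asum_add[OF asum_zero] zero_ssum by blast

lemma asum_least:
  assumes "\<zero> \<in> B" "A \<subseteq> B" "B \<oplus> B \<subseteq> B" shows "asum A \<subseteq> B"
proof
  fix x assume "x \<in> asum A"
  then show "x \<in> B"
    by induction (use assms ssumI in blast)+
qed

lemma asum_ssum: "asum A \<oplus> asum A \<subseteq> asum A"
proof
  fix z assume "z \<in> asum A \<oplus> asum A"
  then obtain x y where xy: "x \<in> asum A" "y \<in> asum A" "z \<in> {x} \<oplus> {y}" by (auto elim: ssumE)
  \<comment> \<open>Induction on the second summand: associativity moves its last generator to the
    end of the whole sum.\<close>
  from xy(2,1,3) show "z \<in> asum A"
  proof (induction arbitrary: z)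
    case asum_zero
    then have "x \<in> C" using asum_subset by blast
    then show ?case using asum_zero zero_ssum[of x] by (auto simp: ssum_commute)
  next
    case (asum_add y' a y)
    have "z \<in> {x} \<oplus> ({y'} \<oplus> {a})" using asum_add.prems(2) _ asum_add.hyps(3) by (rule ssumI) simp
    then have "z \<in> ({x} \<oplus> {y'}) \<oplus> {a}" by (simp add: ssum_assoc)
    then obtain v where "v \<in> {x} \<oplus> {y'}" "z \<in> {v} \<oplus> {a}" by (auto elim: ssumE)
    then show ?case using asum_add.IH asum_add.prems(1) asum_add.hyps(2) asum.asum_add by blast
  qed
qed

lemma asum_mult1:
  assumes "x \<in> asum A" "d \<in> C" "A \<subseteq> C" "\<And>a. a \<in> A \<Longrightarrow> a \<cdot> d \<in> asum B"
  shows "x \<cdot> d \<in> asum B"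
  using assms(1)
proof induction
  case asum_zero
  show ?case using assms(2) by (simp add: asum.asum_zero)
next
  case (asum_add x a y)
  have "x \<in> C" "a \<in> C" using asum_add asum_subset assms(3) by blast+
  then have "y \<cdot> d \<in> {x \<cdot> d} \<oplus> {a \<cdot> d}" using asum_add mult_ssum1 assms(2) by blast
  then have "y \<cdot> d \<in> asum B \<oplus> asum B" using asum_add assms(4) ssumI by blast
  then show ?case using asum_ssum by blast
qed

text \<open>Weak distributivity, \<open>(x + a)d \<subseteq> xd + ad\<close>, suffices:
  \<open>asum_mult1\<close> first expands the left factor into generators, then the right
  one.\<close>

lemma asum_mult:
  assumes "x \<in> asum A" "y \<in> asum B" "A \<subseteq> C" "B \<subseteq> C" "\<And>a b. a \<in> A \<Longrightarrow> b \<in> B \<Longrightarrow> a \<cdot> b \<in> D" "D \<subseteq> C"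
  shows "x \<cdot> y \<in> asum D"
proof (rule asum_mult1[OF assms(1)])
  show yc: "y \<in> C" using assms(2) asum_subset by blast
  fix a assume a: "a \<in> A"
  then have ac: "a \<in> C" using assms by blast
  have "y \<cdot> a \<in> asum D"
  proof (rule asum_mult1[OF assms(2) ac assms(4)])
    fix b assume "b \<in> B"
    then have "b \<in> C" "a \<cdot> b \<in> asum D"
      using assms(5)[OF a, of b] assms(4) asum_incl[OF assms(6)] by blast+
    then show "b \<cdot> a \<in> asum D" using mult_commute[OF ac] by simp
  qed
  then show "a \<cdot> y \<in> asum D" using ac yc by (simp add: mult_commute)
qed fact

text \<open>Commutativity lets each new generator be added to whichever of the two partial sums it
  belongs to.\<close>

lemma asum_Un: "asum (A \<union> B) \<subseteq> asum A \<oplus> asum B"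
proof
  fix x assume "x \<in> asum (A \<union> B)"
  then show "x \<in> asum A \<oplus> asum B"
  proof induction
    case asum_zero
    show ?case using zero_in_ssum[of "asum A" "asum B"] asum_subset asum.asum_zero by blast
  next
    case (asum_add x a y)
    have step: "asum D \<oplus> {a} \<subseteq> asum D" if "a \<in> D" for D
    proof
      fix z assume "z \<in> asum D \<oplus> {a}"
      then obtain x where "x \<in> asum D" "z \<in> {x} \<oplus> {a}" by (rule ssumE) simp
      then show "z \<in> asum D" using that asum.asum_add by blast
    qed
    have "y \<in> (asum A \<oplus> asum B) \<oplus> {a}" using asum_add ssumI by blast
    moreover have "(asum A \<oplus> asum B) \<oplus> {a} = (asum A \<oplus> {a}) \<oplus> asum B"
      "(asum A \<oplus> asum B) \<oplus> {a} = asum A \<oplus> (asum B \<oplus> {a})" by (simp_all add: ssum_ac)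
    moreover have "(asum A \<oplus> {a}) \<oplus> asum B \<subseteq> asum A \<oplus> asum B" if "a \<in> A"
      using step[OF that] by (intro ssum_mono) auto
    moreover have "asum A \<oplus> (asum B \<oplus> {a}) \<subseteq> asum A \<oplus> asum B" if "a \<in> B"
      using step[OF that] by (intro ssum_mono) auto
    ultimately show ?case using asum_add.hyps(2) by auto
  qed
qed

section \<open>Quadratic modules and preorderings\<close>

definition qmodule :: "'a set \<Rightarrow> bool" where
  "qmodule T \<longleftrightarrow> Sq \<subseteq> T \<and> T \<subseteq> C \<and> T \<oplus> T \<subseteq> T \<and> (\<forall>s\<in>Sq. \<forall>t\<in>T. s \<cdot> t \<in> T)"

text \<open>As with \<open>qmodule\<close>, properness is not demanded:
  \<open>\<ominus> \<one>\<close> may belong to \<open>T\<close>, so every cone generated below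
  qualifies.\<close>

definition preord :: "'a set \<Rightarrow> bool" where
  "preord T \<longleftrightarrow> Sq \<subseteq> T \<and> T \<subseteq> C \<and> T \<oplus> T \<subseteq> T \<and> (\<forall>s\<in>T. \<forall>t\<in>T. s \<cdot> t \<in> T)"

lemma preord_qmodule: "preord T \<Longrightarrow> qmodule T"
  by (auto simp: preord_def qmodule_def)

lemma qmodule_asum:
  assumes "Sq \<subseteq> A" "A \<subseteq> C" "\<And>s t. s \<in> Sq \<Longrightarrow> t \<in> A \<Longrightarrow> s \<cdot> t \<in> A"
  shows "qmodule (asum A)"
proof -
  have "s \<cdot> t \<in> asum A" if "s \<in> Sq" "t \<in> asum A" for s t
    using asum_mult[of s Sq t A A] asum_incl[of Sq] that assms Sq_closed by blast
  then show ?thesis using asum_ssum asum_subset asum_incl[of A] assms by (auto simp: qmodule_def)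
qed

lemma preord_asum:
  assumes "Sq \<subseteq> A" "A \<subseteq> C" "\<And>s t. s \<in> A \<Longrightarrow> t \<in> A \<Longrightarrow> s \<cdot> t \<in> A"
  shows "preord (asum A)"
proof -
  have "s \<cdot> t \<in> asum A" if "s \<in> asum A" "t \<in> asum A" for s t
    using asum_mult[of s A t A A] that assms by blast
  then show ?thesis using asum_ssum asum_subset asum_incl[of A] assms by (auto simp: preord_def)
qed

lemma qmodule_ssum: "qmodule T \<Longrightarrow> x \<in> {a} \<oplus> {b} \<Longrightarrow> a \<in> T \<Longrightarrow> b \<in> T \<Longrightarrow> x \<in> T"
  unfolding qmodule_def using ssumI by blast

text \<open>Writing \<open>x \<in> s - 1\<close> with a square \<open>s\<close> gives
  \<open>xy \<in> sy - y\<close>, and both terms lie in \<open>T\<close>. So closure under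
  multiplication by squares already makes the support stable under arbitrary multiples.\<close>

lemma qmodule_support_ideal:
  assumes T: "qmodule T" and y: "y \<in> T" "\<ominus> y \<in> T" and x: "x \<in> C"
  shows "y \<cdot> x \<in> T"
proof -
  obtain s where s: "s \<in> Sq" "x \<in> {s} \<oplus> {\<ominus> \<one>}" using diff_of_squares x by blast
  have yc: "y \<in> C" using T y by (auto simp: qmodule_def)
  have "x \<cdot> y \<in> {s \<cdot> y} \<oplus> {\<ominus> y}"
    using mult_ssum1[OF s(2) Sq_closed[OF s(1)] _ yc] yc by simp
  moreover have "s \<cdot> y \<in> T" using T s y by (auto simp: qmodule_def)
  ultimately have "x \<cdot> y \<in> T" using T y qmodule_ssum by blast
  then show ?thesis using x yc by (simp add: mult_commute)
qed

text \<open>The last clause makes the support, that is \<open>P\<close> intersected with its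
  negative, a prime ideal. These sets are exactly the nonnegative parts of morphisms to
  \<open>Q2\<close>.\<close>

definition ordering :: "'a set \<Rightarrow> bool" where
  "ordering P \<longleftrightarrow> P \<subseteq> C \<and> P \<oplus> P \<subseteq> P \<and> (\<forall>s\<in>P. \<forall>t\<in>P. s \<cdot> t \<in> P) \<and>
     (\<forall>a\<in>C. a \<in> P \<or> \<ominus> a \<in> P) \<and> \<ominus> \<one> \<notin> P \<and>
     (\<forall>a\<in>C. \<forall>b\<in>C. a \<cdot> b \<in> P \<and> \<ominus> (a \<cdot> b) \<in> P \<longrightarrow> a \<in> P \<and> \<ominus> a \<in> P \<or> b \<in> P \<and> \<ominus> b \<in> P)"

definition sign :: "'a set \<Rightarrow> 'a \<Rightarrow> int" where
  "sign P = (\<lambda>a\<in>C. sgn_of (a \<in> P) (\<ominus> a \<in> P))"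

lemma sign_hom:
  assumes P: "ordering P" shows "mr_hom R Q2 (sign P)"
proof -
  have tot: "a \<in> P \<or> \<ominus> a \<in> P" if "a \<in> C" for a using P that by (auto simp: ordering_def)
  have mul: "a \<cdot> b \<in> P" if "a \<in> P" "b \<in> P" for a b using P that by (auto simp: ordering_def)
  have add: "c \<in> P" if "c \<in> {a} \<oplus> {b}" "a \<in> P" "b \<in> P" for a b c
    using P that ssumI unfolding ordering_def by blast
  have prime: "a \<in> P \<and> \<ominus> a \<in> P \<or> b \<in> P \<and> \<ominus> b \<in> P"
    if "a \<in> C" "b \<in> C" "a \<cdot> b \<in> P" "\<ominus> (a \<cdot> b) \<in> P" for a b
    using P that unfolding ordering_def by blast
  have one: "\<one> \<in> P" "\<ominus> \<one> \<notin> P" using P tot[of \<one>] by (auto simp: ordering_def)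
  have zero: "\<zero> \<in> P" using tot[of \<zero>] by simp
  have "sign P c \<in> madd Q2 (sign P a) (sign P b)"
    if abc: "a \<in> C" "b \<in> C" "c \<in> C" "c \<in> madd R a b" for a b c
  proof -
    \<comment> \<open>Signs depend on membership of elements and of their negatives, so the relation
      is used in all six forms: solved for each of \<open>a\<close>, \<open>b\<close>,
      \<open>c\<close>, and negated.\<close>
    have c: "c \<in> {a} \<oplus> {b}" using abc by (simp add: ssum_singles)
    have a: "a \<in> {c} \<oplus> {\<ominus> b}" using ssum_rev[OF c] abc by simp
    have b: "b \<in> {c} \<oplus> {\<ominus> a}" using ssum_rev[of c b a] c abc by (simp add: ssum_commute)
    have nc: "\<ominus> c \<in> {\<ominus> a} \<oplus> {\<ominus> b}" using neg_ssum[OF c] abc by simp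
    have na: "\<ominus> a \<in> {\<ominus> c} \<oplus> {b}" using neg_ssum[OF a] abc by simp
    have nb: "\<ominus> b \<in> {\<ominus> c} \<oplus> {a}" using neg_ssum[OF b] abc by simp
    have "sgn_of (c \<in> P) (\<ominus> c \<in> P) \<in> madd Q2 (sgn_of (a \<in> P) (\<ominus> a \<in> P)) (sgn_of (b \<in> P) (\<ominus> b \<in> P))"
      using add[OF c] add[OF a] add[OF b] add[OF nc] add[OF na] add[OF nb] tot[OF abc(1)] tot[OF abc(2)] tot[OF abc(3)]
      by (intro sgn_of_add) blast+
    then show ?thesis using abc by (simp add: sign_def)
  qed
  moreover have "sign P (a \<cdot> b) = sign P a * sign P b" if ab: "a \<in> C" "b \<in> C" for a b
  proof -
    have "a \<in> P \<and> b \<in> P \<or> \<ominus> a \<in> P \<and> \<ominus> b \<in> P \<longrightarrow> a \<cdot> b \<in> P"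
      "a \<in> P \<and> \<ominus> b \<in> P \<or> \<ominus> a \<in> P \<and> b \<in> P \<longrightarrow> \<ominus> (a \<cdot> b) \<in> P"
      using mul[of a b] mul[of "\<ominus> a" b] mul[of a "\<ominus> b"] mul[of "\<ominus> a" "\<ominus> b"] ab by auto
    then have "sgn_of (a \<cdot> b \<in> P) (\<ominus> (a \<cdot> b) \<in> P) = sgn_of (a \<in> P) (\<ominus> a \<in> P) * sgn_of (b \<in> P) (\<ominus> b \<in> P)"
      using tot[OF ab(1)] tot[OF ab(2)] prime[OF ab] by (intro sgn_of_mult) blast+
    then show ?thesis using ab by (simp add: sign_def)
  qed
  moreover have "sign P (\<ominus> a) = - sign P a" if "a \<in> C" for a
    using that tot[OF that] by (auto simp: sign_def sgn_of_def)
  moreover have "sign P \<zero> = 0" "sign P \<one> = 1"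
    using one zero by (simp_all add: sign_def sgn_of_def)
  moreover have "sign P \<in> C \<rightarrow>\<^sub>E {-1, 0, 1}"
    by (auto simp: sign_def sgn_of_def)
  ultimately show ?thesis unfolding mr_hom_def by (simp add: Q2_def)
qed

lemma sign_nonneg: "a \<in> C \<Longrightarrow> 0 \<le> sign P a \<longleftrightarrow> a \<in> P"
  by (simp add: sign_def sgn_of_def)

section \<open>Maximal preorderings are orderings\<close>

lemma preord_Union_chain:
  assumes "\<And>T. T \<in> K \<Longrightarrow> preord T" "K \<noteq> {}" "\<And>S T. S \<in> K \<Longrightarrow> T \<in> K \<Longrightarrow> S \<subseteq> T \<or> T \<subseteq> S"
  shows "preord (\<Union>K)"
proof -
  have two: "\<exists>T\<in>K. x \<in> T \<and> y \<in> T" if "x \<in> \<Union>K" "y \<in> \<Union>K" for x y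
    using that assms(3) by blast
  have "x \<in> \<Union>K" if x: "x \<in> \<Union>K \<oplus> \<Union>K" for x
  proof -
    obtain a b where "a \<in> \<Union>K" "b \<in> \<Union>K" "x \<in> {a} \<oplus> {b}" using x by (rule ssumE)
    then obtain T where "T \<in> K" "a \<in> T" "b \<in> T" "x \<in> {a} \<oplus> {b}" using two by blast
    then show ?thesis using assms(1)[of T] qmodule_ssum preord_qmodule by blast
  qed
  moreover have "x \<cdot> y \<in> \<Union>K" if "x \<in> \<Union>K" "y \<in> \<Union>K" for x y
    using two[OF that] assms(1) unfolding preord_def by blast
  moreover have "Sq \<subseteq> \<Union>K" "\<Union>K \<subseteq> C" using assms(1,2) unfolding preord_def by blast+
  ultimately show ?thesis unfolding preord_def by blast
qed

text \<open>The set \<open>T \<union> aT\<close> is closed under products because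
  \<open>a \<cdot> a\<close> lies in \<open>T\<close>; its additive closure is therefore already a
  preordering.\<close>

lemma preord_adjoin:
  assumes T: "preord T" and a: "a \<in> C"
  shows "preord (asum (T \<union> (\<lambda>t. a \<cdot> t) ` T))" (is "preord (asum ?M)")
    and "T \<subseteq> asum (T \<union> (\<lambda>t. a \<cdot> t) ` T)" and "a \<in> asum (T \<union> (\<lambda>t. a \<cdot> t) ` T)"
proof -
  have TC: "T \<subseteq> C" and sqT: "Sq \<subseteq> T" and mulT: "\<And>s t. s \<in> T \<Longrightarrow> t \<in> T \<Longrightarrow> s \<cdot> t \<in> T"
    using T by (auto simp: preord_def)
  have MC: "?M \<subseteq> C" using TC a by auto
  have aa: "a \<cdot> a \<in> T" using sqT a square_in_Sq by blast
  have M: "x \<cdot> y \<in> ?M" if "x \<in> ?M" "y \<in> ?M" for x y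
  proof -
    have 1: "(a \<cdot> s) \<cdot> (a \<cdot> t) = (a \<cdot> a) \<cdot> (s \<cdot> t)" "(a \<cdot> s) \<cdot> t = a \<cdot> (s \<cdot> t)" "s \<cdot> (a \<cdot> t) = a \<cdot> (s \<cdot> t)"
      if "s \<in> T" "t \<in> T" for s t
      using that TC a by (simp_all add: mult_ac subset_iff)
    show ?thesis using that 1 mulT aa by auto
  qed
  show "preord (asum ?M)" using preord_asum[OF _ MC M] sqT by blast
  show "T \<subseteq> asum ?M" using asum_incl[OF MC] by blast
  have "a \<in> ?M" using image_eqI[of a "\<lambda>t. a \<cdot> t" \<one> T] one_in_Sq sqT a by auto
  then show "a \<in> asum ?M" using asum_incl[OF MC] by blast
qed

text \<open>If \<open>a\<close> and \<open>b\<close> are outside \<open>P\<close>, maximality puts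
  \<open>\<ominus> e\<close> into both extensions, which yields \<open>z\<close> and
  \<open>y\<close> in the additive closures of \<open>aP\<close> and \<open>bP\<close> with
  \<open>\<ominus> z\<close> and \<open>\<ominus> y\<close> in \<open>e + P\<close>. Then
  \<open>zy \<in> e + P\<close>. If moreover \<open>\<ominus> (a \<cdot> b) \<in> P\<close>, then
  \<open>\<ominus> (z \<cdot> y) \<in> P\<close>, and so \<open>\<ominus> e \<in> P\<close>, a
  contradiction. Totality and primeness are both instances of this.\<close>

lemma maximal_preord_ordering:
  assumes P: "preord P" and e: "e \<in> Sq" "\<ominus> e \<notin> P"
    and max: "\<And>T. preord T \<Longrightarrow> P \<subseteq> T \<Longrightarrow> \<ominus> e \<notin> T \<Longrightarrow> T = P"
  shows "ordering P"
proof -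
  have PC: "P \<subseteq> C" and sqP: "Sq \<subseteq> P" and addP: "P \<oplus> P \<subseteq> P"
    and mulP: "\<And>s t. s \<in> P \<Longrightarrow> t \<in> P \<Longrightarrow> s \<cdot> t \<in> P"
    using P by (auto simp: preord_def)
  have ec: "e \<in> C" "e \<in> P" using e sqP Sq_closed by auto
  have wit: "\<exists>z\<in>asum ((\<lambda>t. a \<cdot> t) ` P). \<ominus> z \<in> {e} \<oplus> P" if a: "a \<in> C" "a \<notin> P" for a
  proof -
    let ?M = "P \<union> (\<lambda>t. a \<cdot> t) ` P"
    have "\<ominus> e \<in> asum ?M" using max[of "asum ?M"] preord_adjoin[OF P a(1)] a(2) by blast
    then have "\<ominus> e \<in> asum P \<oplus> asum ((\<lambda>t. a \<cdot> t) ` P)" using asum_Un by blast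
    then obtain t z where tz: "t \<in> asum P" "z \<in> asum ((\<lambda>t. a \<cdot> t) ` P)" "t \<in> C" "z \<in> C" "\<ominus> e \<in> {t} \<oplus> {z}"
      by (rule ssumE)
    have "t \<in> P" using asum_least[of P P] addP sqP zero_in_Sq tz(1) by blast
    have "z \<in> {\<ominus> e} \<oplus> {\<ominus> t}" using ssum_rev[of "\<ominus> e" z t] tz ec by (simp add: ssum_commute)
    then have "\<ominus> z \<in> {e} \<oplus> {t}" using neg_ssum[of z "\<ominus> e" "\<ominus> t"] tz ec by simp
    then show ?thesis using tz(2) \<open>t \<in> P\<close> ssumI[of "\<ominus> z" e t "{e}" P] by blast
  qed
  have contra: False if ab: "a \<in> C" "b \<in> C" "a \<notin> P" "b \<notin> P" "\<ominus> (a \<cdot> b) \<in> P" for a b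
  proof -
    obtain z where z: "z \<in> asum ((\<lambda>t. a \<cdot> t) ` P)" "\<ominus> z \<in> {e} \<oplus> P" using wit ab by blast
    obtain y where y: "y \<in> asum ((\<lambda>t. b \<cdot> t) ` P)" "\<ominus> y \<in> {e} \<oplus> P" using wit ab by blast
    have cl: "z \<in> C" "y \<in> C" using z y asum_subset by blast+
    have "z \<cdot> y \<in> asum ((\<lambda>t. (a \<cdot> b) \<cdot> t) ` P)"
    proof (rule asum_mult[OF z(1) y(1)])
      fix u v assume "u \<in> (\<lambda>t. a \<cdot> t) ` P" "v \<in> (\<lambda>t. b \<cdot> t) ` P"
      then obtain s t where st: "s \<in> P" "t \<in> P" "u = a \<cdot> s" "v = b \<cdot> t" by blast
      then have "s \<in> C" "t \<in> C" using PC by auto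
      then have "u \<cdot> v = (a \<cdot> b) \<cdot> (s \<cdot> t)" using st ab by (simp add: mult_ac)
      then show "u \<cdot> v \<in> (\<lambda>t. (a \<cdot> b) \<cdot> t) ` P" using st mulP by blast
    qed (use PC ab in auto)
    then have "(z \<cdot> y) \<cdot> \<ominus> \<one> \<in> asum P"
    proof (rule asum_mult1)
      fix x assume "x \<in> (\<lambda>t. (a \<cdot> b) \<cdot> t) ` P"
      then obtain t where t: "t \<in> P" "x = (a \<cdot> b) \<cdot> t" by blast
      then have "t \<in> C" using PC by blast
      then have "x \<cdot> \<ominus> \<one> = \<ominus> (a \<cdot> b) \<cdot> t" using t ab by simp
      then show "x \<cdot> \<ominus> \<one> \<in> asum P" using t ab(5) mulP asum_incl[OF PC] by auto
    qed (use PC ab in auto)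
    then have nzy: "\<ominus> (z \<cdot> y) \<in> P" using asum_least[of P P] addP sqP zero_in_Sq cl by auto
    have "\<ominus> z \<cdot> \<ominus> y \<in> {e} \<oplus> P"
    proof -
      have yP: "\<ominus> y \<in> P" using y(2) addP ssum_mono[of "{e}" P P P] ec by blast
      \<comment> \<open>Idempotence of \<open>e\<close> keeps a bare summand \<open>e\<close> when
        \<open>e + P\<close> is multiplied by \<open>e\<close>; all other terms of the product stay
        in \<open>P\<close>.\<close>
      have *: "e \<cdot> \<ominus> y \<in> {e} \<oplus> P"
        using mult_ssum[OF y(2) ec(1), of "{e}" P] e ec mulP PC cl
        by (auto simp: Sq_idem mult_commute)
      have "\<ominus> z \<cdot> \<ominus> y \<in> ({e} \<oplus> P) \<oplus> P"
        using mult_ssum[OF z(2) neg_closed[OF cl(2)], of "{e} \<oplus> P" P] * mulP[OF _ yP] by blast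
      also have "\<dots> \<subseteq> {e} \<oplus> P" using addP ssum_mono[of "{e}" "{e}" "P \<oplus> P" P] by (simp add: ssum_assoc)
      finally show ?thesis .
    qed
    then have "z \<cdot> y \<in> {e} \<oplus> P" using cl by simp
    then obtain t where t: "t \<in> P" "t \<in> C" "z \<cdot> y \<in> {e} \<oplus> {t}" by (auto elim: ssumE)
    have "e \<in> {z \<cdot> y} \<oplus> {\<ominus> t}" using ssum_rev[OF t(3)] t ec by simp
    then have "\<ominus> e \<in> {\<ominus> (z \<cdot> y)} \<oplus> {t}" using neg_ssum[of e "z \<cdot> y" "\<ominus> t"] t cl by simp
    then show False using e(2) nzy t qmodule_ssum[OF preord_qmodule[OF P]] by blast
  qed
  \<comment> \<open>With \<open>b = \<ominus> a\<close>, the element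
    \<open>\<ominus> (a \<cdot> b)\<close> is the square of \<open>a\<close>.\<close>
  have tot: "a \<in> P \<or> \<ominus> a \<in> P" if "a \<in> C" for a
    using contra[of a "\<ominus> a"] that subsetD[OF sqP square_in_Sq[OF that]] by auto
  \<comment> \<open>Both \<open>a \<cdot> b\<close> and its negative lie in \<open>P\<close>, so
    \<open>contra\<close> applies to all four choices of signs. If neither factor were in the
    support, one of these choices would be violated.\<close>
  have "a \<in> P \<and> \<ominus> a \<in> P \<or> b \<in> P \<and> \<ominus> b \<in> P" if "a \<in> C" "b \<in> C" "a \<cdot> b \<in> P" "\<ominus> (a \<cdot> b) \<in> P" for a b
    using contra[of a b] contra[of "\<ominus> a" b] contra[of a "\<ominus> b"] contra[of "\<ominus> a" "\<ominus> b"] that by auto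
  moreover have "\<ominus> \<one> \<notin> P" using e(2) mulP[of "\<ominus> \<one>" e] ec by auto
  ultimately show ?thesis using PC addP mulP tot unfolding ordering_def by blast
qed

text \<open>Zorn's lemma extends \<open>T\<close> to a preordering maximal among those avoiding
  \<open>\<ominus> e\<close>. It is an ordering, and its sign is positive at \<open>e\<close>
  because it contains the square \<open>e\<close> but not \<open>\<ominus> e\<close>.\<close>

lemma Positivstellensatz:
  assumes T: "preord T" and e: "e \<in> Sq" "\<ominus> e \<notin> T"
  obtains \<sigma> where "\<sigma> \<in> ARS_pts R" "\<And>t. t \<in> T \<Longrightarrow> 0 \<le> \<sigma> t" "\<sigma> e > 0"
proof -
  let ?Z = "{S. preord S \<and> T \<subseteq> S \<and> \<ominus> e \<notin> S}"
  have "\<exists>P\<in>?Z. \<forall>S\<in>?Z. P \<subseteq> S \<longrightarrow> S = P"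
  proof (rule subset_Zorn_nonempty)
    show "?Z \<noteq> {}" using T e by auto
    fix K assume K: "K \<noteq> {}" "subset.chain ?Z K"
    then have "preord (\<Union>K)"
      by (intro preord_Union_chain) (auto simp: subset_chain_def)
    then show "\<Union>K \<in> ?Z" using K by (auto simp: subset_chain_def)
  qed
  then obtain P where P: "preord P" "T \<subseteq> P" "\<ominus> e \<notin> P"
    and max: "\<And>S. preord S \<Longrightarrow> T \<subseteq> S \<Longrightarrow> \<ominus> e \<notin> S \<Longrightarrow> P \<subseteq> S \<Longrightarrow> S = P" by auto
  have ord: "ordering P" using maximal_preord_ordering[OF P(1) e(1) P(3)] max P(2) by blast
  have PC: "P \<subseteq> C" "Sq \<subseteq> P" using P(1) by (auto simp: preord_def)
  show ?thesis
  proof (rule that)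
    show "sign P \<in> ARS_pts R" using sign_hom[OF ord] by (simp add: ARS_pts_def)
    show "0 \<le> sign P t" if "t \<in> T" for t using that P(2) PC sign_nonneg by blast
    show "sign P e > 0" using P(3) PC e(1) by (auto simp: sign_def sgn_of_def)
  qed
qed

text \<open>Absorption of one summand after another: \<open>e \<cdot> y\<close> lies in the sum of
  \<open>e \<cdot> x\<close> and \<open>e \<cdot> a\<close>, and each of these leaves
  \<open>Y\<close> stable. It reduces absorption of a whole cone to its generators.\<close>

lemma absorb_asum:
  assumes e: "e \<in> C" and A: "A \<subseteq> C" and gen: "\<And>a. a \<in> A \<Longrightarrow> {e \<cdot> a} \<oplus> Y \<subseteq> Y" and Y: "Y \<subseteq> C"
    and x: "x \<in> asum A"
  shows "{e \<cdot> x} \<oplus> Y \<subseteq> Y"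
  using x
proof induction
  case asum_zero
  show ?case using e zero_ssum_set[OF Y] by simp
next
  case (asum_add x a y)
  have cl: "x \<in> C" "a \<in> C" "y \<in> C" using asum_add A asum_subset ssumD by blast+
  have "e \<cdot> y \<in> {e \<cdot> x} \<oplus> {e \<cdot> a}"
    using mult_ssum1[OF asum_add.hyps(3) cl(1,2) e] cl e by (simp add: mult_commute)
  then have "{e \<cdot> y} \<oplus> Y \<subseteq> ({e \<cdot> x} \<oplus> {e \<cdot> a}) \<oplus> Y" by (intro ssum_mono) auto
  also have "\<dots> = {e \<cdot> x} \<oplus> ({e \<cdot> a} \<oplus> Y)" by (simp add: ssum_assoc)
  also have "\<dots> \<subseteq> {e \<cdot> x} \<oplus> Y" using gen[OF asum_add.hyps(2)] by (intro ssum_mono) auto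
  also have "\<dots> \<subseteq> Y" by fact
  finally show ?case .
qed


section \<open>The representation theorem\<close>

text \<open>In contrast with \<open>asum\<close>, each listed summand is taken exactly once; this is
  the normal form in which all coefficients are 1.\<close>

primrec lsum :: "'a list \<Rightarrow> 'a set" where
  "lsum [] = {\<zero>}"
| "lsum (x # xs) = {x} \<oplus> lsum xs"

lemma lsum_subset: "lsum xs \<subseteq> C"
  by (cases xs) (simp_all add: ssum_subset)

lemma lsum_absorb:
  assumes "x \<in> set xs" "x \<in> C" "s \<in> Sq" shows "{x \<cdot> s} \<oplus> lsum xs = lsum xs"
  using assms(1)
proof (induction xs)
  case (Cons y xs)
  show ?case
  proof (cases "y = x")
    case True
    then show ?thesis
      using absorb_left[OF assms(2,3), of "lsum xs"] by (simp add: ssum_left_commute)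
  next
    case False
    then have "{x \<cdot> s} \<oplus> lsum xs = lsum xs" using Cons by auto
    then show ?thesis by (simp add: ssum_left_commute[of "{x \<cdot> s}"])
  qed
qed simp

lemma lsum_neg: "set xs \<subseteq> C \<Longrightarrow> \<zero> \<in> lsum (map (\<lambda>x. \<ominus> x) xs) \<oplus> lsum xs"
proof (induction xs)
  case Nil
  then show ?case using zero_ssum[of \<zero>] by simp
next
  case (Cons x xs)
  then have "\<zero> \<in> ({x} \<oplus> {\<ominus> x}) \<oplus> (lsum (map (\<lambda>x. \<ominus> x) xs) \<oplus> lsum xs)"
    using zero_in_diff[of x] zero_ssum[of \<zero>] ssumI[of \<zero> \<zero> \<zero>] by simp
  then show ?case by (simp add: ssum_ac)
qed

text \<open>Once \<open>\<one>\<close> is among the generators, the additive closure of this set is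
  the quadratic module that they generate.\<close>

definition sqmult :: "'a list \<Rightarrow> 'a set" where
  "sqmult gs = {s \<cdot> g | s g. s \<in> Sq \<and> g \<in> set gs}"

lemma sqmult_subset: "set gs \<subseteq> C \<Longrightarrow> sqmult gs \<subseteq> C"
  using Sq_closed by (auto simp: sqmult_def)

lemma sqmult_mult:
  assumes "set gs \<subseteq> C" "s \<in> Sq" "t \<in> sqmult gs" shows "s \<cdot> t \<in> sqmult gs"
proof -
  obtain r g where rg: "r \<in> Sq" "g \<in> set gs" "t = r \<cdot> g" using assms(3) by (auto simp: sqmult_def)
  have "s \<cdot> t = (s \<cdot> r) \<cdot> g" using rg assms Sq_closed by (simp add: mult_assoc subset_iff)
  then show ?thesis using rg Sq_mult[OF assms(2)] by (auto simp: sqmult_def)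
qed

lemma sqmult_gen:
  assumes "set gs \<subseteq> C" "g \<in> set gs" shows "g \<in> sqmult gs"
proof -
  have "g = \<one> \<cdot> g" using assms by auto
  then show ?thesis using assms one_in_Sq unfolding sqmult_def by blast
qed

lemma Sq_sqmult: "Sq \<subseteq> sqmult (\<one> # gs)"
proof
  fix s assume s: "s \<in> Sq"
  then have "s = s \<cdot> \<one>" using Sq_closed by simp
  then show "s \<in> sqmult (\<one> # gs)" using s unfolding sqmult_def by force
qed

text \<open>The sum of the generators absorbs every \<open>e\<close>-multiple of an element of the cone they span; if
  \<open>\<ominus> e\<close> lies in the cone, this applies to the negatives of the generators themselves, and all
  coefficients can be normalised to 1.\<close>

lemma zero_in_lsum:
  assumes gs: "set gs \<subseteq> C" and e: "e \<in> Sq" and M: "qmodule (asum (sqmult gs))"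
    and neg: "\<ominus> e \<in> asum (sqmult gs)"
  shows "\<zero> \<in> lsum (map (\<lambda>g. e \<cdot> g) gs)" (is "\<zero> \<in> ?Y")
proof -
  have ec: "e \<in> C" using e Sq_closed by blast
  have gen: "{e \<cdot> a} \<oplus> ?Y \<subseteq> ?Y" if a: "a \<in> sqmult gs" for a
  proof -
    obtain s g where sg: "s \<in> Sq" "g \<in> set gs" "a = s \<cdot> g" using a by (auto simp: sqmult_def)
    then have "g \<in> C" "s \<in> C" using gs Sq_closed by auto
    then have "e \<cdot> a = (e \<cdot> g) \<cdot> s" using sg ec by (simp add: mult_ac)
    then show ?thesis using lsum_absorb[of "e \<cdot> g" _ s] sg \<open>g \<in> C\<close> ec by simp
  qed
  \<comment> \<open>Both \<open>e\<close> and \<open>\<ominus> e\<close> lie in the cone, so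
    \<open>e\<close> is in its support, which is an ideal. Hence \<open>e \<cdot> x\<close> is
    absorbed for every \<open>x\<close> in the carrier.\<close>
  have stab: "{e \<cdot> x} \<oplus> ?Y \<subseteq> ?Y" if "x \<in> C" for x
  proof -
    have "e \<cdot> x \<in> asum (sqmult gs)"
      using qmodule_support_ideal[OF M _ neg that] M e by (auto simp: qmodule_def)
    then have "{e \<cdot> (e \<cdot> x)} \<oplus> ?Y \<subseteq> ?Y" using absorb_asum[OF ec sqmult_subset[OF gs] gen lsum_subset] by blast
    moreover have "e \<cdot> (e \<cdot> x) = e \<cdot> x" using mult_assoc[of e e x] ec that e by (simp add: Sq_idem)
    ultimately show ?thesis by simp
  qed
  have "lsum (map (\<lambda>x. e \<cdot> x) xs) \<oplus> ?Y \<subseteq> ?Y" if "set xs \<subseteq> C" for xs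
    using that
  proof (induction xs)
    case Nil
    then show ?case using zero_ssum_set[OF lsum_subset] by simp
  next
    case (Cons x xs)
    then have "{e \<cdot> x} \<oplus> (lsum (map (\<lambda>x. e \<cdot> x) xs) \<oplus> ?Y) \<subseteq> {e \<cdot> x} \<oplus> ?Y"
      by (intro ssum_mono) auto
    then show ?case using stab[of x] Cons.prems by (simp add: ssum_assoc)
  qed
  moreover have "set (map (\<lambda>x. \<ominus> x) gs) \<subseteq> C" using gs by auto
  \<comment> \<open>Taking the negated generators for \<open>xs\<close> keeps the sum of
    \<open>?Y\<close> and its termwise negative inside \<open>?Y\<close>; by \<open>lsum_neg\<close>
    that sum contains zero.\<close>
  ultimately have "lsum (map (\<lambda>x. e \<cdot> x) (map (\<lambda>x. \<ominus> x) gs)) \<oplus> ?Y \<subseteq> ?Y" by blast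
  moreover have neg_map: "map (\<lambda>x. e \<cdot> x) (map (\<lambda>x. \<ominus> x) gs) = map (\<lambda>x. \<ominus> x) (map (\<lambda>x. e \<cdot> x) gs)"
    using gs ec by auto
  moreover have "set (map (\<lambda>x. e \<cdot> x) gs) \<subseteq> C" using gs ec by auto
  ultimately show ?thesis using lsum_neg[of "map (\<lambda>x. e \<cdot> x) gs"] unfolding neg_map by blast
qed

section \<open>Membership in hypersums decided by the orderings\<close>

lemma ARS_ptsD:
  assumes "\<sigma> \<in> ARS_pts R"
  shows "\<sigma> \<in> extensional C" and "a \<in> C \<Longrightarrow> \<sigma> a \<in> {-1, 0, 1}"
    and "a \<in> C \<Longrightarrow> \<sigma> (\<ominus> a) = - \<sigma> a" and "\<sigma> \<zero> = 0" and "\<sigma> \<one> = 1"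
    and "a \<in> C \<Longrightarrow> b \<in> C \<Longrightarrow> \<sigma> (a \<cdot> b) = \<sigma> a * \<sigma> b"
    and "a \<in> C \<Longrightarrow> b \<in> C \<Longrightarrow> c \<in> madd R a b \<Longrightarrow> \<sigma> c \<in> madd Q2 (\<sigma> a) (\<sigma> b)"
  using assms madd_closed[of a b c]
  by (auto simp: ARS_pts_def mr_hom_def Q2_def PiE_def Pi_def)

text \<open>The hypothesis says that \<open>c\<close> lies in the value set \<open>D(a,b)\<close> at
  every ordering, which leaves \<open>a\<close> and \<open>b\<close> unconstrained where
  \<open>c\<close> vanishes. The factors \<open>c \<cdot> c\<close> in the conclusion remove them
  there.\<close>

lemma represented:
  assumes abc: "a \<in> C" "b \<in> C" "c \<in> C"
    and pos: "\<And>\<sigma>. \<sigma> \<in> ARS_pts R \<Longrightarrow> \<sigma> c = 0 \<or> \<sigma> a * \<sigma> c > 0 \<or> \<sigma> b * \<sigma> c > 0"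
  shows "c \<in> {a \<cdot> (c \<cdot> c)} \<oplus> {b \<cdot> (c \<cdot> c)}"
proof -
  define e u v where "e = c \<cdot> c" and "u = a \<cdot> c" and "v = b \<cdot> c"
  have cl: "e \<in> C" "u \<in> C" "v \<in> C" and e: "e \<in> Sq" using abc by (simp_all add: e_def u_def v_def)
  have eu: "e \<cdot> u = u" and ev: "e \<cdot> v = v" using abc by (simp_all add: e_def u_def v_def mult_ac)
  have euv: "e \<cdot> (u \<cdot> v) = u \<cdot> v" using cl eu by (simp flip: mult_assoc)
  have zeros: "{x} \<oplus> {\<zero>} = {x}" if "x \<in> C" for x
    using zero_ssum[OF that] by (simp add: ssum_commute)

  \<comment> \<open>\<open>?T\<close> lists the products of distinct elements among
    \<open>\<ominus> u\<close> and \<open>\<ominus> v\<close> and so generates a preordering.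
    \<open>?N\<close> omits \<open>u \<cdot> v\<close> and generates only a quadratic module;
    normalising there leaves no mixed term.\<close>
  let ?T = "[\<one>, \<ominus> u, \<ominus> v, u \<cdot> v]" and ?N = "[\<one>, \<ominus> u, \<ominus> v]"
  have Tcl: "set ?T \<subseteq> C" and Ncl: "set ?N \<subseteq> C" using cl by auto
  have N: "qmodule (asum (sqmult ?N))"
    by (rule qmodule_asum[OF Sq_sqmult sqmult_subset[OF Ncl] sqmult_mult[OF Ncl]])
  have T: "preord (asum (sqmult ?T))"
  proof (rule preord_asum[OF Sq_sqmult sqmult_subset[OF Tcl]])
    fix x y assume "x \<in> sqmult ?T" "y \<in> sqmult ?T"
    then obtain s t g h where x: "x = s \<cdot> g" "y = t \<cdot> h" "s \<in> Sq" "t \<in> Sq" "g \<in> set ?T" "h \<in> set ?T"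
      unfolding sqmult_def by blast
    have "s \<in> C" "t \<in> C" "g \<in> C" "h \<in> C" using x Sq_closed Tcl by blast+
    then have xy: "x \<cdot> y = (s \<cdot> t) \<cdot> (g \<cdot> h)" using x by (simp add: mult_ac)
    \<comment> \<open>In a product of two generators a repeated factor contributes a square, so
      \<open>?T\<close> is closed under products up to square coefficients.\<close>
    have gens: "\<one> \<in> sqmult ?T" "\<ominus> u \<in> sqmult ?T" "\<ominus> v \<in> sqmult ?T" "u \<cdot> v \<in> sqmult ?T"
      by (rule sqmult_gen[OF Tcl], simp)+
    have squares: "u \<cdot> u \<in> sqmult ?T" "v \<cdot> v \<in> sqmult ?T" "(u \<cdot> v) \<cdot> (u \<cdot> v) \<in> sqmult ?T"
      using subsetD[OF Sq_sqmult square_in_Sq] cl mult_closed[OF cl(2,3)] by blast+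
    have "(u \<cdot> u) \<cdot> \<ominus> v \<in> sqmult ?T" "(v \<cdot> v) \<cdot> \<ominus> u \<in> sqmult ?T"
      using sqmult_mult[OF Tcl square_in_Sq] gens cl by blast+
    moreover have "(u \<cdot> u) \<cdot> \<ominus> v = \<ominus> (u \<cdot> (u \<cdot> v))" "(u \<cdot> u) \<cdot> \<ominus> v = \<ominus> ((u \<cdot> v) \<cdot> u)"
      "(v \<cdot> v) \<cdot> \<ominus> u = \<ominus> (v \<cdot> (u \<cdot> v))" "(v \<cdot> v) \<cdot> \<ominus> u = \<ominus> ((u \<cdot> v) \<cdot> v)" "v \<cdot> u = u \<cdot> v"
      using cl by (simp_all add: mult_ac)
    ultimately have table: "\<ominus> (u \<cdot> (u \<cdot> v)) \<in> sqmult ?T" "\<ominus> ((u \<cdot> v) \<cdot> u) \<in> sqmult ?T"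
      "\<ominus> (v \<cdot> (u \<cdot> v)) \<in> sqmult ?T" "\<ominus> ((u \<cdot> v) \<cdot> v) \<in> sqmult ?T" "v \<cdot> u \<in> sqmult ?T"
      using gens by simp_all
    have "g = \<one> \<or> g = \<ominus> u \<or> g = \<ominus> v \<or> g = u \<cdot> v" "h = \<one> \<or> h = \<ominus> u \<or> h = \<ominus> v \<or> h = u \<cdot> v"
      using x(5,6) by simp_all
    then have "g \<cdot> h \<in> sqmult ?T"
      by (elim disjE) (simp_all add: cl gens squares table)
    then show "x \<cdot> y \<in> sqmult ?T" unfolding xy by (rule sqmult_mult[OF Tcl Sq_mult[OF x(3,4)]])
  qed
  have "\<ominus> e \<in> asum (sqmult ?T)"
  proof (rule ccontr)
    assume "\<ominus> e \<notin> asum (sqmult ?T)"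
    then obtain \<sigma> where \<sigma>: "\<sigma> \<in> ARS_pts R" "\<And>t. t \<in> asum (sqmult ?T) \<Longrightarrow> 0 \<le> \<sigma> t" "\<sigma> e > 0"
      using Positivstellensatz[OF T e] by blast
    have "\<ominus> u \<in> asum (sqmult ?T)" "\<ominus> v \<in> asum (sqmult ?T)"
      using asum_incl[OF sqmult_subset[OF Tcl]] sqmult_gen[OF Tcl] by auto
    then have "0 \<le> \<sigma> (\<ominus> u)" "0 \<le> \<sigma> (\<ominus> v)" using \<sigma>(2) by blast+
    then show False using \<sigma>(1,3) pos[OF \<sigma>(1)] abc ARS_ptsD[OF \<sigma>(1)] by (auto simp: e_def u_def v_def)
  qed
  then have "\<zero> \<in> lsum (map (\<lambda>g. e \<cdot> g) ?T)"
    by (rule zero_in_lsum[OF Tcl e preord_qmodule[OF T]])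
  \<comment> \<open>Zero in a sum of two hypersums yields opposite elements of them; this produces
    one \<open>w\<close> lying in both \<open>e + uv\<close> and \<open>u + v\<close>.\<close>
  also have "\<dots> = ({e} \<oplus> {u \<cdot> v}) \<oplus> ({\<ominus> u} \<oplus> {\<ominus> v})"
    using cl eu ev euv by (simp add: zeros) (simp add: ssum_ac)
  finally obtain w w' where w: "w \<in> {e} \<oplus> {u \<cdot> v}" "w' \<in> {\<ominus> u} \<oplus> {\<ominus> v}" "w \<in> C" "w' \<in> C"
    "\<zero> \<in> {w} \<oplus> {w'}" by (rule ssumE)
  have w_eq: "w = \<ominus> w'" using neg_unique w by blast
  have wuv: "w \<in> {u} \<oplus> {v}" using neg_ssum[OF w(2)] cl w_eq by simp

  \<comment> \<open>Multiplying \<open>w \<in> e + uv\<close> by \<open>u\<close> and by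
    \<open>v\<close> adds only square multiples of \<open>v\<close> and \<open>u\<close>. These are
    absorbed in \<open>w \<cdot> w \<in> wu + wv\<close>.\<close>
  have "w \<cdot> u \<in> {u} \<oplus> {v \<cdot> (u \<cdot> u)}" using mult_ssum1[OF w(1), of u] cl eu by (simp add: mult_ac)
  moreover have "w \<cdot> v \<in> {v} \<oplus> {u \<cdot> (v \<cdot> v)}" using mult_ssum1[OF w(1), of v] cl ev by (simp add: mult_ac)
  moreover have "w \<cdot> w \<in> {w \<cdot> u} \<oplus> {w \<cdot> v}"
    using mult_ssum1[OF wuv, of w] cl w by (simp add: mult_commute)
  ultimately have "w \<cdot> w \<in> ({u} \<oplus> {v \<cdot> (u \<cdot> u)}) \<oplus> ({v} \<oplus> {u \<cdot> (v \<cdot> v)})" by (meson ssumI)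
  also have "\<dots> = ({u} \<oplus> {u \<cdot> (v \<cdot> v)}) \<oplus> ({v} \<oplus> {v \<cdot> (u \<cdot> u)})" by (simp add: ssum_ac)
  also have "\<dots> = {u} \<oplus> {v}" using cl by (simp add: absorb)
  finally have ww: "w \<cdot> w \<in> {u} \<oplus> {v}" .

  let ?S = "asum (sqmult ?N)"
  have nu: "\<ominus> u \<in> ?S" "\<ominus> v \<in> ?S" using asum_incl[OF sqmult_subset[OF Ncl]] sqmult_gen[OF Ncl] by auto
  \<comment> \<open>Now \<open>w \<cdot> w\<close> is in the support of \<open>?S\<close>, hence so
    is its multiple by \<open>w\<close>, which is \<open>w\<close> itself. From
    \<open>u \<in> w - v\<close> also \<open>u\<close>, and then \<open>u \<cdot> v\<close>, lies in
    \<open>?S\<close>. Finally \<open>\<ominus> e \<in> \<ominus> w + uv\<close>.\<close>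
  have "w \<cdot> w \<in> ?S" using N w(3) by (auto simp: qmodule_def)
  moreover have "\<ominus> (w \<cdot> w) \<in> ?S" using qmodule_ssum[OF N neg_ssum[OF ww] nu] cl by blast
  ultimately have "(w \<cdot> w) \<cdot> w \<in> ?S" using qmodule_support_ideal[OF N] w(3) by blast
  then have wS: "w \<in> ?S" using w(3) by (simp add: mult_assoc)
  have nwS: "\<ominus> w \<in> ?S" using qmodule_ssum[OF N neg_ssum[OF wuv] nu] cl by blast
  have "u \<in> ?S" using qmodule_ssum[OF N ssum_rev[OF wuv] wS nu(2)] cl by blast
  then have "u \<cdot> v \<in> ?S" using qmodule_support_ideal[OF N _ nu(1)] cl by blast
  moreover have "\<ominus> e \<in> {\<ominus> w} \<oplus> {u \<cdot> v}"
    using neg_ssum[OF ssum_rev[OF w(1)]] cl w(3) by simp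
  ultimately have "\<ominus> e \<in> ?S" using qmodule_ssum[OF N] nwS by blast
  \<comment> \<open>Normalising over three generators gives \<open>0 \<in> e - u - v\<close>, that
    is \<open>e \<in> u + v\<close>. Multiplication by \<open>c\<close> turns \<open>e\<close> back
    into \<open>c\<close>.\<close>
  then have "\<zero> \<in> lsum (map (\<lambda>g. e \<cdot> g) ?N)" by (rule zero_in_lsum[OF Ncl e N])
  also have "\<dots> = {e} \<oplus> ({\<ominus> u} \<oplus> {\<ominus> v})"
    using cl eu ev by (simp add: zeros)
  finally obtain z where z: "z \<in> {\<ominus> u} \<oplus> {\<ominus> v}" "z \<in> C" "\<zero> \<in> {e} \<oplus> {z}"
    by (auto elim: ssumE)
  have "e = \<ominus> z" using neg_unique z cl by blast
  then have "e \<in> {u} \<oplus> {v}" using neg_ssum[OF z(1)] cl by simp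
  from mult_ssum1[OF this, of c] show ?thesis using abc by (simp add: e_def u_def v_def mult_assoc)
qed

theorem madd_iff:
  assumes abc: "a \<in> C" "b \<in> C" "c \<in> C"
  shows "c \<in> madd R a b \<longleftrightarrow> (\<forall>\<sigma>\<in>ARS_pts R. \<sigma> c \<in> madd Q2 (\<sigma> a) (\<sigma> b))"
proof
  assume "c \<in> madd R a b"
  then show "\<forall>\<sigma>\<in>ARS_pts R. \<sigma> c \<in> madd Q2 (\<sigma> a) (\<sigma> b)" using ARS_ptsD(7) abc by blast
next
  assume "\<forall>\<sigma>\<in>ARS_pts R. \<sigma> c \<in> madd Q2 (\<sigma> a) (\<sigma> b)"
  then have local: "\<sigma> a * \<sigma> c > 0 \<or> \<sigma> b * \<sigma> c > 0 \<or> \<sigma> c = 0 \<and> \<sigma> b = - \<sigma> a" if "\<sigma> \<in> ARS_pts R" for \<sigma>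
    using that by (auto simp: Q2_def)
  have c: "c \<in> {a \<cdot> (c \<cdot> c)} \<oplus> {b \<cdot> (c \<cdot> c)}"
    using local by (intro represented abc) blast
  have a: "a \<in> {c \<cdot> (a \<cdot> a)} \<oplus> {\<ominus> b \<cdot> (a \<cdot> a)}"
  \<comment> \<open>The relation \<open>c \<in> a + b\<close> can be solved for \<open>a\<close>
    pointwise in \<open>Q2\<close>, so the signs satisfy the hypothesis of
    \<open>represented\<close> for \<open>a\<close> against \<open>c\<close> and
    \<open>\<ominus> b\<close>.\<close>
  proof (intro represented abc neg_closed)
    fix \<sigma> assume \<sigma>: "\<sigma> \<in> ARS_pts R"
    then have "\<sigma> a \<in> {-1,0,1}" "\<sigma> b \<in> {-1,0,1}" "\<sigma> c \<in> {-1,0,1}" using ARS_ptsD abc by blast+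
    then show "\<sigma> a = 0 \<or> 0 < \<sigma> c * \<sigma> a \<or> 0 < \<sigma> (\<ominus> b) * \<sigma> a"
      using local[OF \<sigma>] ARS_ptsD(3)[OF \<sigma> abc(2)] by auto
  qed
  have b: "b \<in> {c \<cdot> (b \<cdot> b)} \<oplus> {\<ominus> a \<cdot> (b \<cdot> b)}"
  proof (intro represented abc neg_closed)
    fix \<sigma> assume \<sigma>: "\<sigma> \<in> ARS_pts R"
    then have "\<sigma> a \<in> {-1,0,1}" "\<sigma> b \<in> {-1,0,1}" "\<sigma> c \<in> {-1,0,1}" using ARS_ptsD abc by blast+
    then show "\<sigma> b = 0 \<or> 0 < \<sigma> c * \<sigma> b \<or> 0 < \<sigma> (\<ominus> a) * \<sigma> b"
      using local[OF \<sigma>] ARS_ptsD(3)[OF \<sigma> abc(1)] by auto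
  qed
  have ca: "c \<cdot> (a \<cdot> a) \<in> {a} \<oplus> {b \<cdot> (a \<cdot> a)}" using ssum_rev'[of a "c \<cdot> (a \<cdot> a)" "b \<cdot> (a \<cdot> a)"] a abc by simp
  have cb: "c \<cdot> (b \<cdot> b) \<in> {b} \<oplus> {a \<cdot> (b \<cdot> b)}" using ssum_rev'[of b "c \<cdot> (b \<cdot> b)" "a \<cdot> (b \<cdot> b)"] b abc by simp
  \<comment> \<open>Adding square multiples of \<open>c\<close> to \<open>c\<close> changes nothing.
    After substitution and regrouping, every square multiple of \<open>a\<close> or \<open>b\<close>
    stands next to \<open>a\<close> or \<open>b\<close> and is absorbed.\<close>
  have "c \<in> {c} \<oplus> ({c \<cdot> (a \<cdot> a)} \<oplus> {c \<cdot> (b \<cdot> b)})" using abc by (simp add: absorb absorb_left)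
  also have "\<dots> \<subseteq> ({a \<cdot> (c \<cdot> c)} \<oplus> {b \<cdot> (c \<cdot> c)}) \<oplus>
      (({a} \<oplus> {b \<cdot> (a \<cdot> a)}) \<oplus> ({b} \<oplus> {a \<cdot> (b \<cdot> b)}))"
    using c ca cb by (intro ssum_mono) auto
  also have "\<dots> = ({a} \<oplus> ({a \<cdot> (c \<cdot> c)} \<oplus> {a \<cdot> (b \<cdot> b)})) \<oplus> ({b} \<oplus> ({b \<cdot> (c \<cdot> c)} \<oplus> {b \<cdot> (a \<cdot> a)}))"
    by (simp add: ssum_ac)
  also have "\<dots> = {a} \<oplus> {b}" using abc by (simp add: absorb absorb_left)
  finally show "c \<in> madd R a b" using abc by (simp add: ssum_singles)
qed

section \<open>The spectrum of a real reduced multiring\<close>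

text \<open>Over an empty spectrum the criterion \<open>madd_iff\<close> would hold vacuously and
  put \<open>\<one>\<close> into \<open>0 + 0 = {0}\<close>.\<close>

lemma ARS_pts_nonempty: "ARS_pts R \<noteq> {}"
proof
  assume "ARS_pts R = {}"
  then have "\<one> \<in> madd R \<zero> \<zero>" using madd_iff[of \<zero> \<zero> \<one>] by simp
  then show False using zero_ssum[of \<zero>] one_neq_zero by (simp add: ssum_singles)
qed

lemma hatf_eq [simp]: "\<sigma> \<in> ARS_pts R \<Longrightarrow> hatf R a \<sigma> = \<sigma> a"
  by (simp add: hatf_def)

text \<open>Equality is an instance of hyperaddition, \<open>a \<in> 0 + b\<close>, and is therefore
  decided by the orderings.\<close>

lemma inj_on_hatf: "inj_on (hatf R) C"
proof (rule inj_onI)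
  fix a b assume ab: "a \<in> C" "b \<in> C" and eq: "hatf R a = hatf R b"
  have "a \<in> madd R \<zero> b"
    unfolding madd_iff[OF zero_closed ab(2,1)]
  proof
    fix \<sigma> assume \<sigma>: "\<sigma> \<in> ARS_pts R"
    then have "\<sigma> a = \<sigma> b" using fun_cong[OF eq, of \<sigma>] by simp
    then show "\<sigma> a \<in> madd Q2 (\<sigma> \<zero>) (\<sigma> b)"
      using ARS_ptsD(2)[OF \<sigma> ab(2)] by (auto simp: ARS_ptsD(4)[OF \<sigma>] madd_Q2)
  qed
  then show "a = b" using zero_ssum[OF ab(2)] ab by (simp add: ssum_singles)
qed

lemma hatf_mult: "a \<in> C \<Longrightarrow> b \<in> C \<Longrightarrow> hatf R (a \<cdot> b) = fprod (hatf R a) (hatf R b)"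
  and hatf_neg: "a \<in> C \<Longrightarrow> hatf R (\<ominus> a) = fneg (hatf R a)"
  and hatf_zero: "hatf R \<zero> = const_on (ARS_pts R) 0"
  and hatf_one: "hatf R \<one> = const_on (ARS_pts R) 1"
  by (auto simp: hatf_def fprod_def fneg_def const_on_def ARS_ptsD intro!: ext)

lemma hatf_Dtset:
  assumes "a \<in> C" "b \<in> C" "c \<in> C"
  shows "hatf R c \<in> Dtset (ARS_pts R) (ARS_fns R) (hatf R a) (hatf R b) \<longleftrightarrow> c \<in> madd R a b"
proof -
  have "hatf R c \<in> ARS_fns R" using assms by (simp add: ARS_fns_def)
  moreover have "\<sigma> c \<in> {-1, 0, 1}" if "\<sigma> \<in> ARS_pts R" for \<sigma> using ARS_ptsD(2)[OF that assms(3)] .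
  ultimately show ?thesis unfolding madd_iff[OF assms] Dtset_def madd_Q2 by auto
qed

text \<open>The preimage of \<open>P\<close> under \<open>hatf R\<close> is an ordering of
  \<open>R\<close>, and its sign is the required point. Closure under hypersums follows from closure
  under \<open>Dset\<close>, which contains \<open>Dtset\<close>.\<close>

lemma AX2_ARS_pts:
  fixes P
  defines "X \<equiv> ARS_pts R" and "G \<equiv> ARS_fns R"
  assumes PG: "P \<subseteq> G" and mul: "\<forall>a\<in>P. \<forall>b\<in>P. fprod a b \<in> P" and tot: "P \<union> fneg ` P = G"
    and one: "const_on X (-1) \<notin> P" and add: "\<forall>a\<in>P. \<forall>b\<in>P. Dset X G a b \<subseteq> P"
    and prime: "\<forall>a\<in>G. \<forall>b\<in>G. fprod a b \<in> P \<inter> fneg ` P \<longrightarrow> a \<in> P \<inter> fneg ` P \<or> b \<in> P \<inter> fneg ` P"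
  shows "\<exists>x\<in>X. P = {a \<in> G. a x \<ge> 0}"
proof -
  define Q where "Q = {a \<in> C. hatf R a \<in> P}"
  have neg: "hatf R a \<in> fneg ` P \<longleftrightarrow> \<ominus> a \<in> Q" if "a \<in> C" for a
  proof -
    have "fneg (fneg f) = f" for f :: "('a \<Rightarrow> int) \<Rightarrow> int" by (simp add: fneg_def)
    then have "f \<in> fneg ` P \<longleftrightarrow> fneg f \<in> P" for f by (metis image_iff)
    then show ?thesis using that by (simp add: Q_def hatf_neg)
  qed
  have memQ: "a \<in> Q \<longleftrightarrow> hatf R a \<in> P" if "a \<in> C" for a using that by (simp add: Q_def)
  have "ordering Q"
    unfolding ordering_def
  proof (intro conjI ballI subsetI impI)
    fix a assume "a \<in> Q" then show "a \<in> C" by (simp add: Q_def)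
  next
    fix c assume c: "c \<in> Q \<oplus> Q"
    then obtain a b where ab: "a \<in> Q" "b \<in> Q" "a \<in> C" "b \<in> C" "c \<in> {a} \<oplus> {b}" by (rule ssumE)
    have cc: "c \<in> C" using c ssumD by blast
    have "hatf R c \<in> Dtset X G (hatf R a) (hatf R b)"
      unfolding X_def G_def using ab cc by (simp add: hatf_Dtset ssum_singles)
    then have "hatf R c \<in> Dset X G (hatf R a) (hatf R b)" by (auto simp: Dset_def Dtset_def)
    then show "c \<in> Q" using add ab(1,2) cc by (auto simp: Q_def)
  next
    fix a b assume "a \<in> Q" "b \<in> Q"
    then show "a \<cdot> b \<in> Q" using mul by (auto simp: Q_def hatf_mult)
  next
    fix a assume a: "a \<in> C"
    then have "hatf R a \<in> P \<union> fneg ` P" unfolding tot by (simp add: G_def ARS_fns_def)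
    then show "a \<in> Q \<or> \<ominus> a \<in> Q" using neg[OF a] memQ[OF a] by blast
  next
    have "hatf R (\<ominus> \<one>) = const_on X (-1)"
      by (auto simp: hatf_neg hatf_one X_def fneg_def const_on_def)
    then show "\<ominus> \<one> \<notin> Q" using one by (simp add: Q_def)
  next
    fix a b assume ab: "a \<in> C" "b \<in> C" "a \<cdot> b \<in> Q \<and> \<ominus> (a \<cdot> b) \<in> Q"
    then have "fprod (hatf R a) (hatf R b) \<in> P \<inter> fneg ` P"
      using neg[of "a \<cdot> b"] memQ[of "a \<cdot> b"] by (simp add: hatf_mult)
    moreover have "hatf R a \<in> G" "hatf R b \<in> G" using ab by (simp_all add: G_def ARS_fns_def)
    ultimately have "hatf R a \<in> P \<inter> fneg ` P \<or> hatf R b \<in> P \<inter> fneg ` P" using prime by blast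
    then show "a \<in> Q \<and> \<ominus> a \<in> Q \<or> b \<in> Q \<and> \<ominus> b \<in> Q"
      using neg[OF ab(1)] neg[OF ab(2)] memQ[OF ab(1)] memQ[OF ab(2)] by blast
  qed
  then have X: "sign Q \<in> X" using sign_hom by (simp add: X_def ARS_pts_def)
  have "hatf R a \<in> P \<longleftrightarrow> 0 \<le> hatf R a (sign Q)" if "a \<in> C" for a
    using that X sign_nonneg[OF that, of Q] memQ[OF that] by (simp add: X_def)
  then have "P = {a \<in> G. a (sign Q) \<ge> 0}" using PG by (auto simp: G_def ARS_fns_def)
  then show ?thesis using X by blast
qed

text \<open>Through \<open>hatf_Dtset\<close>, AX3 becomes associativity in \<open>R\<close>. Points
  are separated because they are extensional functions on the carrier.\<close>

lemma ARS_ARS_pts: "ARS (ARS_pts R) (ARS_fns R)"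
  unfolding ARS_def
proof (intro conjI)
  let ?X = "ARS_pts R" and ?G = "ARS_fns R"
  have hatG: "hatf R a \<in> ?G" if "a \<in> C" for a using that by (simp add: ARS_fns_def)
  show "?X \<noteq> {}" by (rule ARS_pts_nonempty)
  show "\<forall>a\<in>?G. sgnfun ?X a"
  proof
    fix f assume "f \<in> ?G"
    then obtain a where a: "a \<in> C" "f = hatf R a" by (auto simp: ARS_fns_def)
    show "sgnfun ?X f" unfolding sgnfun_def a(2) using ARS_ptsD(2)[OF _ a(1)] by (auto simp: hatf_def)
  qed
  show "\<forall>a\<in>?G. \<forall>b\<in>?G. fprod a b \<in> ?G"
  proof (intro ballI)
    fix f g assume "f \<in> ?G" "g \<in> ?G"
    then obtain a b where "a \<in> C" "b \<in> C" "f = hatf R a" "g = hatf R b" by (auto simp: ARS_fns_def)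
    then show "fprod f g \<in> ?G" using hatG[of "a \<cdot> b"] by (simp add: hatf_mult)
  qed
  have "const_on ?X (-1) = hatf R (\<ominus> \<one>)"
    by (auto simp: hatf_neg hatf_one fneg_def const_on_def)
  then show "const_on ?X (-1) \<in> ?G" using hatG by simp
  show "const_on ?X 0 \<in> ?G" "const_on ?X 1 \<in> ?G"
    using hatG[of \<zero>] hatG[of \<one>] by (simp_all add: hatf_zero hatf_one)
  show "\<forall>x\<in>?X. \<forall>y\<in>?X. x \<noteq> y \<longrightarrow> (\<exists>a\<in>?G. a x \<noteq> a y)"
  proof (intro ballI impI)
    fix x y assume xy: "x \<in> ?X" "y \<in> ?X" "x \<noteq> y"
    have "\<exists>a\<in>C. x a \<noteq> y a"
      using extensionalityI[OF ARS_ptsD(1)[OF xy(1)] ARS_ptsD(1)[OF xy(2)]] xy(3) by metis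
    then obtain a where "a \<in> C" "x a \<noteq> y a" by blast
    then show "\<exists>a\<in>?G. a x \<noteq> a y" using hatG[of a] xy by (intro bexI[of _ "hatf R a"]) auto
  qed
  show "\<forall>P. P \<subseteq> ?G \<and> const_on ?X 1 \<in> P \<and> (\<forall>a\<in>P. \<forall>b\<in>P. fprod a b \<in> P) \<and>
          P \<union> fneg ` P = ?G \<and> const_on ?X (-1) \<notin> P \<and>
          (\<forall>a\<in>P. \<forall>b\<in>P. Dset ?X ?G a b \<subseteq> P) \<and>
          (\<forall>a\<in>?G. \<forall>b\<in>?G. fprod a b \<in> P \<inter> fneg ` P \<longrightarrow> a \<in> P \<inter> fneg ` P \<or> b \<in> P \<inter> fneg ` P)
        \<longrightarrow> (\<exists>x\<in>?X. P = {a \<in> ?G. a x \<ge> 0})"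
    by (intro allI impI, elim conjE) (rule AX2_ARS_pts)
  show "\<forall>a\<in>?G. \<forall>b\<in>?G. \<forall>c\<in>?G. \<forall>p\<in>?G.
        (\<exists>q\<in>Dtset ?X ?G b c. p \<in> Dtset ?X ?G a q) \<longrightarrow> (\<exists>r\<in>Dtset ?X ?G a b. p \<in> Dtset ?X ?G r c)"
  proof (intro ballI impI)
    fix a' b' c' p' assume in_G: "a' \<in> ?G" "b' \<in> ?G" "c' \<in> ?G" "p' \<in> ?G"
      and ex: "\<exists>q\<in>Dtset ?X ?G b' c'. p' \<in> Dtset ?X ?G a' q"
    then obtain q' where q': "q' \<in> Dtset ?X ?G b' c'" "p' \<in> Dtset ?X ?G a' q'" by blast
    then have "q' \<in> ?G" by (simp add: Dtset_def)
    with in_G obtain a b c p q where cl: "a \<in> C" "b \<in> C" "c \<in> C" "p \<in> C" "q \<in> C"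
      and eq: "a' = hatf R a" "b' = hatf R b" "c' = hatf R c" "p' = hatf R p" "q' = hatf R q"
      unfolding ARS_fns_def by (auto simp del: hatf_eq elim!: imageE)
    have "q \<in> madd R b c" "p \<in> madd R a q" using q' cl by (simp_all add: eq hatf_Dtset)
    then have "p \<in> (\<Union>w\<in>madd R b c. madd R a w)" by blast
    then have "p \<in> (\<Union>w\<in>madd R a b. madd R w c)" using madd_assoc[rule_format, OF cl(1-3)] by simp
    then obtain r where r: "r \<in> madd R a b" "p \<in> madd R r c" by blast
    then have "r \<in> C" using madd_closed cl by blast
    then show "\<exists>r\<in>Dtset ?X ?G a' b'. p' \<in> Dtset ?X ?G r c'"
      using r cl by (intro bexI[of _ "hatf R r"]) (simp_all add: eq hatf_Dtset)
  qed
qed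

text \<open>The inverse exists by injectivity of \<open>hatf R\<close>; that it respects hypersums
  is the hard direction of \<open>madd_iff\<close>.\<close>

lemma mr_unit_iso: "mr_iso R (mr_of_ARS (ARS_pts R) (ARS_fns R)) (mr_unit R)"
proof -
  let ?X = "ARS_pts R" and ?G = "ARS_fns R"
  let ?S = "mr_of_ARS ?X ?G" and ?g = "restrict (inv_into C (hatf R)) ?G"
  have g: "?g (hatf R a) = a" if "a \<in> C" for a
    using that inj_on_hatf by (simp add: ARS_fns_def)
  have G: "f \<in> ?G \<longleftrightarrow> (\<exists>a\<in>C. f = hatf R a)" for f by (auto simp: ARS_fns_def)
  have "mr_hom R ?S (mr_unit R)"
    unfolding mr_hom_def
    by (auto simp: mr_unit_def mr_of_ARS_def hatf_mult hatf_neg hatf_zero hatf_one hatf_Dtset G)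
  moreover have "mr_hom ?S R ?g"
    unfolding mr_hom_def
  proof (intro conjI ballI impI)
    show "?g \<in> mcar ?S \<rightarrow>\<^sub>E C" by (auto simp: mr_of_ARS_def ARS_fns_def intro: inv_into_into)
    show "?g (mzero ?S) = \<zero>" "?g (mone ?S) = \<one>"
      using g[of \<zero>] g[of \<one>] by (simp_all add: mr_of_ARS_def hatf_zero hatf_one)
  next
    fix a b c assume "a \<in> mcar ?S" "b \<in> mcar ?S" "c \<in> mcar ?S" and c: "c \<in> madd ?S a b"
    then obtain a' b' c' where cl: "a' \<in> C" "b' \<in> C" "c' \<in> C"
      and eq: "a = hatf R a'" "b = hatf R b'" "c = hatf R c'"
      by (auto simp: mr_of_ARS_def G)
    show "?g c \<in> madd R (?g a) (?g b)" using c cl unfolding eq g[OF cl(1)] g[OF cl(2)] g[OF cl(3)]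
      by (simp add: mr_of_ARS_def hatf_Dtset)
  next
    fix a assume "a \<in> mcar ?S"
    then obtain a' where a: "a' \<in> C" "a = hatf R a'" by (auto simp: mr_of_ARS_def G)
    have "?g (mneg ?S a) = ?g (hatf R (\<ominus> a'))" using a by (simp add: mr_of_ARS_def hatf_neg)
    then show "?g (mneg ?S a) = \<ominus> (?g a)" using g[of a'] g[of "\<ominus> a'"] a by simp
  next
    fix a b assume "a \<in> mcar ?S" "b \<in> mcar ?S"
    then obtain a' b' where a: "a' \<in> C" "a = hatf R a'" "b' \<in> C" "b = hatf R b'"
      by (auto simp: mr_of_ARS_def G)
    have "?g (mmul ?S a b) = ?g (hatf R (a' \<cdot> b'))" using a by (simp add: mr_of_ARS_def hatf_mult)
    then show "?g (mmul ?S a b) = ?g a \<cdot> ?g b" using g[of a'] g[of b'] g[of "a' \<cdot> b'"] a by simp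
  qed
  moreover have "compose C ?g (mr_unit R) = restrict id C"
  proof
    fix a
    show "compose C ?g (mr_unit R) a = restrict id C a"
      using g[of a] by (cases "a \<in> C") (simp_all add: compose_def mr_unit_def ARS_fns_def)
  qed
  moreover have "compose (mcar ?S) (mr_unit R) ?g = restrict id (mcar ?S)"
  proof
    fix f
    show "compose (mcar ?S) (mr_unit R) ?g f = restrict id (mcar ?S) f"
    proof (cases "f \<in> ?G")
      case True
      then obtain a where a: "a \<in> C" "f = hatf R a" unfolding G by blast
      then show ?thesis using g[OF a(1)] True by (simp add: compose_def mr_of_ARS_def mr_unit_def)
    qed (simp add: compose_def mr_of_ARS_def)
  qed
  ultimately show ?thesis unfolding mr_iso_def by blast
qed

end

section \<open>The multiring of an abstract real spectrum\<close>

context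
  fixes X :: "'x set" and G :: "('x \<Rightarrow> int) set"
  assumes ARS: "ARS X G"
begin

lemma ARS_axioms:
  shows ARS_nonempty: "X \<noteq> {}"
    and ARS_sgnfun: "\<forall>a\<in>G. sgnfun X a"
    and ARS_fprod: "\<forall>a\<in>G. \<forall>b\<in>G. fprod a b \<in> G"
    and ARS_minus_one: "const_on X (-1) \<in> G"
    and ARS_zero: "const_on X 0 \<in> G"
    and ARS_one: "const_on X 1 \<in> G"
    and ARS_separates: "\<forall>x\<in>X. \<forall>y\<in>X. x \<noteq> y \<longrightarrow> (\<exists>a\<in>G. a x \<noteq> a y)"
    and ARS_orderings: "\<forall>P. P \<subseteq> G \<and> const_on X 1 \<in> P \<and> (\<forall>a\<in>P. \<forall>b\<in>P. fprod a b \<in> P) \<and>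
          P \<union> fneg ` P = G \<and> const_on X (-1) \<notin> P \<and>
          (\<forall>a\<in>P. \<forall>b\<in>P. Dset X G a b \<subseteq> P) \<and>
          (\<forall>a\<in>G. \<forall>b\<in>G. fprod a b \<in> P \<inter> fneg ` P \<longrightarrow> a \<in> P \<inter> fneg ` P \<or> b \<in> P \<inter> fneg ` P)
        \<longrightarrow> (\<exists>x\<in>X. P = {a \<in> G. a x \<ge> 0})"
    and ARS_assoc: "\<forall>a\<in>G. \<forall>b\<in>G. \<forall>c\<in>G. \<forall>p\<in>G.
        (\<exists>q\<in>Dtset X G b c. p \<in> Dtset X G a q) \<longrightarrow> (\<exists>r\<in>Dtset X G a b. p \<in> Dtset X G r c)"
  by (insert ARS[unfolded ARS_def], (elim conjE, assumption)+)

lemma ARS_values: "a \<in> G \<Longrightarrow> x \<in> X \<Longrightarrow> a x = -1 \<or> a x = 0 \<or> a x = 1"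
  and ARS_outside: "a \<in> G \<Longrightarrow> x \<notin> X \<Longrightarrow> a x = 0"
  using ARS_sgnfun unfolding sgnfun_def by blast+

lemma ARS_eqI: "a \<in> G \<Longrightarrow> b \<in> G \<Longrightarrow> (\<And>x. x \<in> X \<Longrightarrow> a x = b x) \<Longrightarrow> a = b"
  using ARS_outside by (metis ext)

lemma ARS_fneg: "a \<in> G \<Longrightarrow> fneg a \<in> G"
proof -
  assume a: "a \<in> G"
  have "fneg a = fprod (const_on X (-1)) a"
    using ARS_outside[OF a] by (auto simp: fneg_def fprod_def const_on_def)
  then show ?thesis using ARS_fprod ARS_minus_one a by simp
qed

lemma Dtset_commute: "Dtset X G a b = Dtset X G b a"
  by (auto simp: Dtset_def)

text \<open>AX3 supplies the element: since \<open>a \<in> a + 0\<close> and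
  \<open>0 \<in> b + (-b)\<close>, reassociating \<open>a + (b + (-b))\<close> produces some
  \<open>r \<in> a + b\<close>.\<close>

lemma Dtset_nonempty:
  assumes "a \<in> G" "b \<in> G" shows "Dtset X G a b \<noteq> {}"
proof -
  let ?q = "const_on X 0"
  have "?q \<in> Dtset X G b (fneg b)" using ARS_zero by (auto simp: Dtset_def const_on_def fneg_def)
  moreover have "a \<in> Dtset X G a ?q"
    using assms ARS_values[OF assms(1)] by (force simp: Dtset_def const_on_def)
  ultimately have "\<exists>r\<in>Dtset X G a b. a \<in> Dtset X G r (fneg b)"
    using ARS_assoc ARS_fneg assms by blast
  then show ?thesis by blast
qed

text \<open>AX3 is one inclusion. The other is AX3 with \<open>a\<close> and \<open>c\<close>
  exchanged, by commutativity.\<close>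

lemma Dtset_assoc:
  assumes "a \<in> G" "b \<in> G" "c \<in> G"
  shows "(\<Union>w\<in>Dtset X G a b. Dtset X G w c) = (\<Union>w\<in>Dtset X G b c. Dtset X G a w)"
proof -
  have sub: "(\<Union>w\<in>Dtset X G b c. Dtset X G a w) \<subseteq> (\<Union>w\<in>Dtset X G a b. Dtset X G w c)"
    if abc: "a \<in> G" "b \<in> G" "c \<in> G" for a b c
  proof
    fix p assume "p \<in> (\<Union>w\<in>Dtset X G b c. Dtset X G a w)"
    then have "\<exists>q\<in>Dtset X G b c. p \<in> Dtset X G a q" "p \<in> G" by (auto simp: Dtset_def)
    then show "p \<in> (\<Union>w\<in>Dtset X G a b. Dtset X G w c)" using ARS_assoc abc by blast
  qed
  have "(\<Union>w\<in>Dtset X G a b. Dtset X G w c) = (\<Union>w\<in>Dtset X G b a. Dtset X G c w)"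
    by (simp add: Dtset_commute[of b] Dtset_commute[of c])
  also have "\<dots> \<subseteq> (\<Union>w\<in>Dtset X G c b. Dtset X G w a)" using sub[OF assms(3,2,1)] .
  also have "\<dots> = (\<Union>w\<in>Dtset X G b c. Dtset X G a w)"
    by (simp add: Dtset_commute[of c] Dtset_commute[of _ a])
  finally show ?thesis using sub[OF assms] by blast
qed

text \<open>Reduces hyperaddition in \<open>G\<close> to \<open>Q2\<close> at each point, where the
  axioms become finite checks on signs.\<close>

lemma Dtset_iff:
  "c \<in> G \<Longrightarrow> c \<in> Dtset X G a b \<longleftrightarrow> (\<forall>x\<in>X. c x \<in> madd Q2 (a x) (b x))"
  using ARS_values[of c] by (auto simp: Dtset_def madd_Q2)

lemma Dtset_in_G: "c \<in> Dtset X G a b \<Longrightarrow> c \<in> G"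
  by (simp add: Dtset_def)

lemma multiring_mr_of_ARS: "multiring (mr_of_ARS X G)"
  unfolding multiring_def mr_of_ARS_def mring.simps
proof (intro conjI ballI impI)
  fix x y z assume xyz: "x \<in> G" "y \<in> G" "z \<in> G" and z: "z \<in> Dtset X G x y"
  have "x t \<in> madd Q2 (z t) (- y t) \<and> y t \<in> madd Q2 (- x t) (z t)" if t: "t \<in> X" for t
  proof -
    have "z t \<in> madd Q2 (x t) (y t)" using z t Dtset_iff[OF xyz(3)] by blast
    then show ?thesis
      using ARS_values[OF xyz(1) t] ARS_values[OF xyz(2) t] ARS_values[OF xyz(3) t]
      by (elim disjE) (simp_all add: madd_Q2)
  qed
  then show "x \<in> Dtset X G z (fneg y)" "y \<in> Dtset X G (fneg x) z"
    using xyz by (simp_all add: Dtset_iff fneg_def)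
next
  fix x y assume xy: "x \<in> G" "y \<in> G"
  have "y t \<in> madd Q2 0 (x t) \<longleftrightarrow> y t = x t" if t: "t \<in> X" for t
    using ARS_values[OF xy(1) t] ARS_values[OF xy(2) t] by (elim disjE) (simp_all add: madd_Q2)
  then have "y \<in> Dtset X G (const_on X 0) x \<longleftrightarrow> (\<forall>t\<in>X. y t = x t)"
    using xy by (simp add: Dtset_iff const_on_def)
  also have "\<dots> \<longleftrightarrow> y = x" using ARS_eqI[OF xy(2,1)] by blast
  finally show "y \<in> Dtset X G (const_on X 0) x \<longleftrightarrow> y = x" .
next
  fix a b c d assume abcd: "a \<in> G" "b \<in> G" "c \<in> G" "d \<in> G" and c: "c \<in> Dtset X G a b"
  have "c t * d t \<in> madd Q2 (a t * d t) (b t * d t)" if t: "t \<in> X" for t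
  proof -
    have "c t \<in> madd Q2 (a t) (b t)" using c t Dtset_iff[OF abcd(3)] by blast
    then show ?thesis
      using ARS_values[OF abcd(4) t] by (elim disjE) (auto simp: madd_Q2)
  qed
  then show "fprod c d \<in> Dtset X G (fprod a d) (fprod b d)"
    using ARS_fprod abcd by (simp add: Dtset_iff) (simp add: fprod_def)
next
  fix a assume a: "a \<in> G"
  show "fprod (const_on X 1) a = a"
    using ARS_outside[OF a] by (auto simp: fprod_def const_on_def)
qed (use ARS_zero ARS_one ARS_fneg ARS_fprod Dtset_nonempty Dtset_assoc Dtset_commute Dtset_in_G in
  \<open>auto simp: fprod_def const_on_def mult_ac\<close>)

lemma real_reduced_mr_of_ARS: "real_reduced (mr_of_ARS X G)"
  unfolding real_reduced_def
proof (intro conjI multiring_mr_of_ARS ballI impI; unfold mr_of_ARS_def mring.simps)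
  show "const_on X 1 \<noteq> const_on X 0"
    using ARS_nonempty by (auto simp: const_on_def fun_eq_iff)
next
  fix a assume a: "a \<in> G"
  show "fprod (fprod a a) a = a"
  proof
    fix t show "fprod (fprod a a) a t = a t"
      using ARS_values[OF a, of t] ARS_outside[OF a, of t] by (cases "t \<in> X") (auto simp: fprod_def)
  qed
next
  fix a b c assume abc: "a \<in> G" "b \<in> G" "c \<in> G" and c: "c \<in> Dtset X G a (fprod a (fprod b b))"
  show "c = a"
  proof (rule ARS_eqI[OF abc(3,1)])
    fix t assume t: "t \<in> X"
    have "c t \<in> madd Q2 (a t) (a t * (b t * b t))"
      using c t Dtset_iff[OF abc(3)] by (simp add: fprod_def)
    then show "c t = a t"
      using ARS_values[OF abc(1) t] ARS_values[OF abc(2) t] by (elim disjE) (auto simp: madd_Q2)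
  qed
next
  fix a b c d assume abc: "a \<in> G" "b \<in> G" "c \<in> G" "d \<in> G"
    and cd: "c \<in> Dtset X G (fprod a a) (fprod b b) \<and> d \<in> Dtset X G (fprod a a) (fprod b b)"
  show "c = d"
  proof (rule ARS_eqI[OF abc(3,4)])
    fix t assume t: "t \<in> X"
    have "c t \<in> madd Q2 (a t * a t) (b t * b t)" "d t \<in> madd Q2 (a t * a t) (b t * b t)"
      using cd t Dtset_iff[OF abc(3)] Dtset_iff[OF abc(4)] by (simp_all add: fprod_def)
    then show "c t = d t"
      using ARS_values[OF abc(1) t] ARS_values[OF abc(2) t] by (elim disjE) (auto simp: madd_Q2)
  qed
qed

lemma eval_hom:
  assumes x: "x \<in> X" shows "(\<lambda>a\<in>G. a x) \<in> ARS_pts (mr_of_ARS X G)"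
proof -
  have "c x \<in> madd Q2 (a x) (b x)" if "c \<in> Dtset X G a b" for a b c
    using that x Dtset_iff[OF Dtset_in_G[OF that]] by blast
  moreover have "a x \<in> {-1, 0, 1}" if "a \<in> G" for a using ARS_values[OF that x] by blast
  ultimately show ?thesis
    using x ARS_zero ARS_one ARS_fneg ARS_fprod unfolding ARS_pts_def mr_hom_def mr_of_ARS_def Q2_def
    by (auto simp: fneg_def fprod_def const_on_def)
qed

text \<open>The nonnegative part of \<open>\<sigma>\<close> satisfies the conditions of AX2 and so
  is cut out by a point \<open>x\<close>. Comparing nonnegativity at \<open>a\<close> and at
  \<open>fneg a\<close> then shows that \<open>\<sigma>\<close> is evaluation at
  \<open>x\<close>.\<close>

lemma ARS_pts_eval:
  assumes \<sigma>: "\<sigma> \<in> ARS_pts (mr_of_ARS X G)"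
  obtains x where "x \<in> X" "\<sigma> = (\<lambda>a\<in>G. a x)"
proof -
  interpret real_reduced_multiring "mr_of_ARS X G"
    by unfold_locales (rule real_reduced_mr_of_ARS)
  have sel: "mcar (mr_of_ARS X G) = G" "mmul (mr_of_ARS X G) = fprod" "mneg (mr_of_ARS X G) = fneg"
    "mone (mr_of_ARS X G) = const_on X 1" "madd (mr_of_ARS X G) = Dtset X G"
    by (simp_all add: mr_of_ARS_def)
  note pt = ARS_ptsD[OF \<sigma>, unfolded sel]
  have fneg2: "fneg (fneg f) = f" for f :: "'x \<Rightarrow> int" by (simp add: fneg_def)
  have m1: "const_on X (-1) = fneg (const_on X 1)" by (auto simp: fneg_def const_on_def)
  define P where "P = {a \<in> G. \<sigma> a \<ge> 0}"
  have nP: "a \<in> fneg ` P \<longleftrightarrow> \<sigma> a \<le> 0" if "a \<in> G" for a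
  proof
    assume "a \<in> fneg ` P"
    then obtain b where "b \<in> P" "a = fneg b" by blast
    then show "\<sigma> a \<le> 0" using pt(3)[of b] by (simp add: P_def)
  next
    assume "\<sigma> a \<le> 0"
    then have "fneg a \<in> P" using pt(3)[OF that] ARS_fneg[OF that] by (simp add: P_def)
    then show "a \<in> fneg ` P" using image_eqI[of a fneg "fneg a" P] fneg2[of a] by simp
  qed
  have "P \<subseteq> G \<and> const_on X 1 \<in> P \<and> (\<forall>a\<in>P. \<forall>b\<in>P. fprod a b \<in> P) \<and>
          P \<union> fneg ` P = G \<and> const_on X (-1) \<notin> P \<and>
          (\<forall>a\<in>P. \<forall>b\<in>P. Dset X G a b \<subseteq> P) \<and>
          (\<forall>a\<in>G. \<forall>b\<in>G. fprod a b \<in> P \<inter> fneg ` P \<longrightarrow> a \<in> P \<inter> fneg ` P \<or> b \<in> P \<inter> fneg ` P)"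
  proof (intro conjI ballI impI)
    show "P \<subseteq> G" by (auto simp: P_def)
    show "const_on X 1 \<in> P" using pt(5) ARS_one by (simp add: P_def)
    show "const_on X (-1) \<notin> P" using pt(3)[OF ARS_one] pt(5) by (simp add: P_def m1)
  next
    fix a b assume "a \<in> P" "b \<in> P"
    then show "fprod a b \<in> P" using pt(6) ARS_fprod by (simp add: P_def)
  next
    have "a \<in> P \<union> fneg ` P" if "a \<in> G" for a using nP[OF that] that by (auto simp: P_def)
    moreover have "fneg ` P \<subseteq> G" using ARS_fneg by (auto simp: P_def)
    ultimately show "P \<union> fneg ` P = G" by (auto simp: P_def)
  next
    fix a b assume ab: "a \<in> P" "b \<in> P"
    show "Dset X G a b \<subseteq> P"
    proof
      fix c assume c: "c \<in> Dset X G a b"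
      \<comment> \<open>\<open>c \<in> D(a,b)\<close> if and only if \<open>c \<in> D\<^sup>t(c\<^sup>2a, c\<^sup>2b)\<close>\<close>
      have cG: "a \<in> G" "b \<in> G" "c \<in> G" using ab c by (auto simp: P_def Dset_def)
      let ?a = "fprod (fprod c c) a" and ?b = "fprod (fprod c c) b"
      have G': "fprod c c \<in> G" "?a \<in> G" "?b \<in> G" using cG ARS_fprod by simp_all
      have "c \<in> Dtset X G ?a ?b"
        unfolding Dtset_iff[OF cG(3)]
      proof
        fix t assume t: "t \<in> X"
        then have "a t * c t > 0 \<or> b t * c t > 0 \<or> c t = 0" using c by (auto simp: Dset_def)
        then show "c t \<in> madd Q2 (?a t) (?b t)"
          using ARS_values[OF cG(3) t] by (elim disjE) (simp_all add: madd_Q2 fprod_def)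
      qed
      then have "\<sigma> c \<in> madd Q2 (\<sigma> ?a) (\<sigma> ?b)" using pt(7) G' by blast
      moreover have "\<sigma> ?a = \<sigma> c * \<sigma> c * \<sigma> a" "\<sigma> ?b = \<sigma> c * \<sigma> c * \<sigma> b"
        using pt(6) cG G' by simp_all
      ultimately have "\<sigma> c \<noteq> -1"
        using ab by (auto simp: madd_Q2 P_def)
      then have "0 \<le> \<sigma> c" using pt(2)[OF cG(3)] by auto
      then show "c \<in> P" using cG by (simp add: P_def)
    qed
  next
    fix a b assume ab: "a \<in> G" "b \<in> G" and supp: "fprod a b \<in> P \<inter> fneg ` P"
    have fG: "fprod a b \<in> G" using ARS_fprod ab by blast
    have "\<sigma> a * \<sigma> b = 0" using supp nP[OF fG] pt(6)[OF ab] by (auto simp: P_def)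
    then show "a \<in> P \<inter> fneg ` P \<or> b \<in> P \<inter> fneg ` P"
      using nP[OF ab(1)] nP[OF ab(2)] ab by (auto simp: P_def)
  qed
  then have "\<exists>x\<in>X. P = {a \<in> G. a x \<ge> 0}" by (rule ARS_orderings[THEN spec, THEN mp])
  then obtain x where x: "x \<in> X" "P = {a \<in> G. a x \<ge> 0}" by (elim bexE)
  have sgn: "0 \<le> \<sigma> a \<longleftrightarrow> 0 \<le> a x" if "a \<in> G" for a
    using that x(2) unfolding P_def by blast
  have "\<sigma> a = a x" if a: "a \<in> G" for a
  proof -
    have "0 \<le> - \<sigma> a \<longleftrightarrow> 0 \<le> - a x"
      using sgn[OF ARS_fneg[OF a]] pt(3)[OF a] by (simp add: fneg_def)
    then show ?thesis using sgn[OF a] pt(2)[OF a] ARS_values[OF a x(1)] by auto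
  qed
  then have "\<sigma> = (\<lambda>a\<in>G. a x)"
    by (intro extensionalityI[OF pt(1)]) auto
  then show ?thesis using that x(1) by blast
qed

text \<open>Surjectivity is \<open>ARS_pts_eval\<close>, hence AX2; injectivity is separation of
  points. The inverse is a morphism because it pulls \<open>a\<close> back to the evaluation
  function of \<open>a\<close>.\<close>

lemma ars_unit_iso: "ars_iso X G (ARS_pts (mr_of_ARS X G)) (ARS_fns (mr_of_ARS X G)) (ars_unit X G)"
proof -
  let ?R = "mr_of_ARS X G"
  let ?Y = "ARS_pts ?R" and ?\<tau> = "ars_unit X G"
  let ?\<psi> = "restrict (inv_into X ?\<tau>) ?Y"
  have sel: "mcar ?R = G" by (simp add: mr_of_ARS_def)
  have \<tau>: "?\<tau> x = (\<lambda>a\<in>G. a x)" if "x \<in> X" for x using that by (simp add: ars_unit_def)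
  have img: "?\<tau> ` X = ?Y"
  proof
    show "?\<tau> ` X \<subseteq> ?Y" using \<tau> eval_hom by auto
    show "?Y \<subseteq> ?\<tau> ` X" by (rule subsetI, erule ARS_pts_eval) (metis \<tau> imageI)
  qed
  have "inj_on ?\<tau> X"
  proof (rule inj_onI)
    fix x y assume xy: "x \<in> X" "y \<in> X" "?\<tau> x = ?\<tau> y"
    have "a x = a y" if "a \<in> G" for a
      using fun_cong[OF xy(3), of a] that xy(1,2) by (simp add: \<tau>)
    then show "x = y" using ARS_separates xy by blast
  qed
  then have left: "?\<psi> (?\<tau> x) = x" if "x \<in> X" for x
    using that img by auto
  have right: "?\<tau> (?\<psi> \<sigma>) = \<sigma>" "?\<psi> \<sigma> \<in> X" if "\<sigma> \<in> ?Y" for \<sigma>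
    using that img f_inv_into_f[of \<sigma> ?\<tau> X] inv_into_into[of \<sigma> ?\<tau> X] by auto
  have hom1: "ars_hom X G ?Y (ARS_fns ?R) ?\<tau>"
    unfolding ars_hom_def
  proof
    show "?\<tau> \<in> X \<rightarrow>\<^sub>E ?Y" using img by (auto simp: ars_unit_def)
    show "\<forall>f\<in>ARS_fns ?R. pull X ?\<tau> f \<in> G"
    proof
      fix f assume "f \<in> ARS_fns ?R"
      then obtain a where a: "a \<in> G" "f = hatf ?R a" by (auto simp: ARS_fns_def sel)
      have "pull X ?\<tau> f = a"
        using a eval_hom ARS_outside[OF a(1)] by (auto simp: pull_def hatf_def \<tau>)
      then show "pull X ?\<tau> f \<in> G" using a by simp
    qed
  qed
  have hom2: "ars_hom ?Y (ARS_fns ?R) X G ?\<psi>"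
    unfolding ars_hom_def
  proof
    show "?\<psi> \<in> ?Y \<rightarrow>\<^sub>E X" using right by auto
    show "\<forall>a\<in>G. pull ?Y ?\<psi> a \<in> ARS_fns ?R"
    proof
      fix a assume a: "a \<in> G"
      have "a (?\<psi> \<sigma>) = \<sigma> a" if "\<sigma> \<in> ?Y" for \<sigma>
        using fun_cong[OF right(1)[OF that], of a] \<tau>[OF right(2)[OF that]] a by simp
      then have "pull ?Y ?\<psi> a = hatf ?R a"
        by (intro ext) (simp add: pull_def hatf_def)
      then show "pull ?Y ?\<psi> a \<in> ARS_fns ?R" using a by (simp add: ARS_fns_def sel)
    qed
  qed
  have c1: "compose X ?\<psi> ?\<tau> = restrict id X"
    using left by (intro ext) (simp add: compose_def del: restrict_apply, simp)
  have c2: "compose ?Y ?\<tau> ?\<psi> = restrict id ?Y"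
    using right by (intro ext) (simp add: compose_def)
  show ?thesis unfolding ars_iso_def using hom1 hom2 c1 c2 by blast
qed

lemma mr_map_id: "mr_map X G (restrict id X) = restrict id G"
  using ARS_outside by (auto simp: mr_map_def pull_def restrict_def fun_eq_iff)

end

section \<open>Functoriality and naturality\<close>

lemma mr_map_hom:
  assumes X: "ARS X G" and Y: "ARS Y H" and \<tau>: "ars_hom X G Y H \<tau>"
  shows "mr_hom (mr_of_ARS Y H) (mr_of_ARS X G) (mr_map X H \<tau>)"
proof -
  have \<tau>X: "\<tau> x \<in> Y" if "x \<in> X" for x using \<tau> that by (auto simp: ars_hom_def)
  have pG: "pull X \<tau> a \<in> G" if "a \<in> H" for a using \<tau> that by (auto simp: ars_hom_def)
  show ?thesis
    unfolding mr_hom_def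
  proof (intro conjI ballI impI; unfold mr_of_ARS_def mring.simps)
    show "mr_map X H \<tau> \<in> H \<rightarrow>\<^sub>E G" using pG by (auto simp: mr_map_def)
    show "mr_map X H \<tau> (const_on Y 0) = const_on X 0" "mr_map X H \<tau> (const_on Y 1) = const_on X 1"
      using ARS_zero[OF Y] ARS_one[OF Y] \<tau>X by (auto simp: mr_map_def pull_def const_on_def)
  next
    fix a b c assume "a \<in> H" "b \<in> H" "c \<in> H" "c \<in> Dtset Y H a b"
    then show "mr_map X H \<tau> c \<in> Dtset X G (mr_map X H \<tau> a) (mr_map X H \<tau> b)"
      using pG \<tau>X by (simp add: mr_map_def Dtset_def) (simp add: pull_def)
  next
    fix a assume "a \<in> H"
    then show "mr_map X H \<tau> (fneg a) = fneg (mr_map X H \<tau> a)"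
      using ARS_fneg[OF Y] by (auto simp: mr_map_def pull_def fneg_def)
  next
    fix a b assume "a \<in> H" "b \<in> H"
    then show "mr_map X H \<tau> (fprod a b) = fprod (mr_map X H \<tau> a) (mr_map X H \<tau> b)"
      using ARS_fprod[OF Y] by (auto simp: mr_map_def pull_def fprod_def)
  qed
qed

lemma mr_map_compose:
  assumes "ars_hom X G Y H \<tau>" "ars_hom Y H Z K \<sigma>"
  shows "mr_map X K (compose X \<sigma> \<tau>) = compose K (mr_map X H \<tau>) (mr_map Y K \<sigma>)"
proof
  fix a
  have "\<tau> x \<in> Y" if "x \<in> X" for x using assms that by (auto simp: ars_hom_def)
  moreover have "pull Y \<sigma> a \<in> H" if "a \<in> K" using assms that by (auto simp: ars_hom_def)
  ultimately show "mr_map X K (compose X \<sigma> \<tau>) a = compose K (mr_map X H \<tau>) (mr_map Y K \<sigma>) a"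
    by (auto simp: mr_map_def compose_def) (auto simp: pull_def)
qed

section \<open>Composing orderings with multiring morphisms\<close>

lemma mr_hom_compose:
  assumes "mr_hom R S f" "mr_hom S T g" "multiring R"
  shows "mr_hom R T (compose (mcar R) g f)"
proof -
  have f: "f a \<in> mcar S" if "a \<in> mcar R" for a using assms(1) that by (auto simp: mr_hom_def)
  have g: "g a \<in> mcar T" if "a \<in> mcar S" for a using assms(2) that by (auto simp: mr_hom_def)
  have "mzero R \<in> mcar R" "mone R \<in> mcar R" "\<forall>a\<in>mcar R. mneg R a \<in> mcar R"
    "\<forall>a\<in>mcar R. \<forall>b\<in>mcar R. mmul R a b \<in> mcar R"
    by (insert assms(3)[unfolded multiring_def], (elim conjE, assumption)+)
  then show ?thesis
    using assms(1,2) f g unfolding mr_hom_def by (simp add: compose_def)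
qed

lemma ars_map_pts:
  assumes "multiring R" "mr_hom R S f" "\<sigma> \<in> ARS_pts S"
  shows "compose (mcar R) \<sigma> f \<in> ARS_pts R"
  using mr_hom_compose[OF assms(2) _ assms(1), of Q2 \<sigma>] assms(3) by (simp add: ARS_pts_def)

text \<open>Evaluating at \<open>\<sigma>\<close> composed with \<open>f\<close> gives
  \<open>\<sigma> (f a)\<close>. This identity yields both the morphism property of
  \<open>ars_map\<close> and the naturality of \<open>mr_unit\<close>.\<close>

lemma pull_ars_map:
  assumes "multiring R" "mr_hom R S f" "a \<in> mcar R"
  shows "pull (ARS_pts S) (ars_map R S f) (hatf R a) = hatf S (f a)"
proof
  fix \<sigma>
  show "pull (ARS_pts S) (ars_map R S f) (hatf R a) \<sigma> = hatf S (f a) \<sigma>"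
    using ars_map_pts[OF assms(1,2), of \<sigma>] assms(3)
    by (simp add: pull_def hatf_def ars_map_def compose_def)
qed

lemma ars_map_hom:
  assumes "multiring R" "mr_hom R S f"
  shows "ars_hom (ARS_pts S) (ARS_fns S) (ARS_pts R) (ARS_fns R) (ars_map R S f)"
proof -
  have "f a \<in> mcar S" if "a \<in> mcar R" for a using assms(2) that by (auto simp: mr_hom_def)
  then have "pull (ARS_pts S) (ars_map R S f) h \<in> ARS_fns S" if "h \<in> ARS_fns R" for h
    using that pull_ars_map[OF assms] by (auto simp: ARS_fns_def)
  moreover have "ars_map R S f \<in> ARS_pts S \<rightarrow>\<^sub>E ARS_pts R"
    using ars_map_pts[OF assms] by (auto simp: ars_map_def)
  ultimately show ?thesis by (auto simp: ars_hom_def)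
qed

lemma ars_map_id: "ars_map R R (restrict id (mcar R)) = restrict id (ARS_pts R)"
proof
  fix \<sigma>
  show "ars_map R R (restrict id (mcar R)) \<sigma> = restrict id (ARS_pts R) \<sigma>"
  proof (cases "\<sigma> \<in> ARS_pts R")
    case True
    then have "\<sigma> \<in> extensional (mcar R)" by (auto simp: ARS_pts_def mr_hom_def PiE_def)
    then have "compose (mcar R) \<sigma> (restrict id (mcar R)) = \<sigma>"
      by (intro extensionalityI[of _ "mcar R"]) (auto simp: compose_def)
    then show ?thesis using True by (simp add: ars_map_def)
  qed (simp add: ars_map_def)
qed

lemma ars_map_compose:
  assumes "multiring R" "multiring S" "mr_hom R S f" "mr_hom S T g"
  shows "ars_map R T (compose (mcar R) g f) = compose (ARS_pts T) (ars_map R S f) (ars_map S T g)"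
proof
  fix \<sigma>
  have "f a \<in> mcar S" if "a \<in> mcar R" for a using assms(3) that by (auto simp: mr_hom_def)
  then show "ars_map R T (compose (mcar R) g f) \<sigma> = compose (ARS_pts T) (ars_map R S f) (ars_map S T g) \<sigma>"
    using ars_map_pts[OF assms(2,4), of \<sigma>]
    by (auto simp: ars_map_def compose_def restrict_def fun_eq_iff)
qed

section \<open>Naturality of the two units\<close>

lemma ars_unit_natural:
  assumes X: "ARS X G" and Y: "ARS Y H" and \<tau>: "ars_hom X G Y H \<tau>"
  shows "compose X (ars_unit Y H) \<tau> =
    compose X (ars_map (mr_of_ARS Y H) (mr_of_ARS X G) (mr_map X H \<tau>)) (ars_unit X G)"
proof
  fix x
  have \<tau>X: "\<tau> x \<in> Y" if "x \<in> X" using \<tau> that by (auto simp: ars_hom_def)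
  have pG: "pull X \<tau> a \<in> G" if "a \<in> H" for a using \<tau> that by (auto simp: ars_hom_def)
  show "compose X (ars_unit Y H) \<tau> x =
    compose X (ars_map (mr_of_ARS Y H) (mr_of_ARS X G) (mr_map X H \<tau>)) (ars_unit X G) x"
  proof (cases "x \<in> X")
    case True
    \<comment> \<open>Both composites send \<open>x\<close> to evaluation at \<open>\<tau> x\<close>
      on \<open>H\<close>.\<close>
    have "ars_map (mr_of_ARS Y H) (mr_of_ARS X G) (mr_map X H \<tau>) (ars_unit X G x)
        = compose H (\<lambda>a\<in>G. a x) (mr_map X H \<tau>)"
      using True eval_hom[OF X True] by (simp add: ars_map_def ars_unit_def) (simp add: mr_of_ARS_def)
    also have "\<dots> = (\<lambda>a\<in>H. a (\<tau> x))"
      using pG True by (auto simp: compose_def mr_map_def restrict_def fun_eq_iff) (auto simp: pull_def)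
    also have "\<dots> = ars_unit Y H (\<tau> x)" using \<tau>X True by (simp add: ars_unit_def)
    finally show ?thesis using True by (simp add: compose_def)
  qed (simp add: compose_def)
qed

lemma mr_unit_natural:
  assumes "multiring R" "mr_hom R S f"
  shows "compose (mcar R) (mr_unit S) f =
    compose (mcar R) (mr_map (ARS_pts S) (ARS_fns R) (ars_map R S f)) (mr_unit R)"
proof
  fix a
  have "f a \<in> mcar S" if "a \<in> mcar R" using assms(2) that by (auto simp: mr_hom_def)
  then show "compose (mcar R) (mr_unit S) f a =
    compose (mcar R) (mr_map (ARS_pts S) (ARS_fns R) (ars_map R S f)) (mr_unit R) a"
    using pull_ars_map[OF assms, of a] by (simp add: compose_def mr_unit_def mr_map_def ARS_fns_def)
qed

theorem theorem4p6:
  shows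
  "\<comment> \<open>the contravariant functor ARS -> MR_red is well defined\<close>
   (\<forall>(X::'x set) G. ARS X G \<longrightarrow> real_reduced (mr_of_ARS X G)) \<and>
   (\<forall>(X::'x set) G (Y::'y set) H \<tau>. ARS X G \<and> ARS Y H \<and> ars_hom X G Y H \<tau> \<longrightarrow>
        mr_hom (mr_of_ARS Y H) (mr_of_ARS X G) (mr_map X H \<tau>)) \<and>
   (\<forall>(X::'x set) G. ARS X G \<longrightarrow> mr_map X G (restrict id X) = restrict id G) \<and>
   (\<forall>(X::'x set) G (Y::'y set) H (Z::'z set) K \<tau> \<sigma>.
        ARS X G \<and> ARS Y H \<and> ARS Z K \<and> ars_hom X G Y H \<tau> \<and> ars_hom Y H Z K \<sigma> \<longrightarrow>
        mr_map X K (compose X \<sigma> \<tau>) = compose K (mr_map X H \<tau>) (mr_map Y K \<sigma>)) \<and>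
   \<comment> \<open>the contravariant functor MR_red -> ARS is well defined\<close>
   (\<forall>(R::'r mring). real_reduced R \<longrightarrow> ARS (ARS_pts R) (ARS_fns R)) \<and>
   (\<forall>(R::'r mring) (S::'s mring) f. real_reduced R \<and> real_reduced S \<and> mr_hom R S f \<longrightarrow>
        ars_hom (ARS_pts S) (ARS_fns S) (ARS_pts R) (ARS_fns R) (ars_map R S f)) \<and>
   (\<forall>(R::'r mring). real_reduced R \<longrightarrow>
        ars_map R R (restrict id (mcar R)) = restrict id (ARS_pts R)) \<and>
   (\<forall>(R::'r mring) (S::'s mring) (T::'t mring) f g.
        real_reduced R \<and> real_reduced S \<and> real_reduced T \<and> mr_hom R S f \<and> mr_hom S T g \<longrightarrow>
        ars_map R T (compose (mcar R) g f) = compose (ARS_pts T) (ars_map R S f) (ars_map S T g)) \<and>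
   \<comment> \<open>natural isomorphism Id_ARS = (composite)\<close>
   (\<forall>(X::'x set) G. ARS X G \<longrightarrow>
        ars_iso X G (ARS_pts (mr_of_ARS X G)) (ARS_fns (mr_of_ARS X G)) (ars_unit X G)) \<and>
   (\<forall>(X::'x set) G (Y::'y set) H \<tau>. ARS X G \<and> ARS Y H \<and> ars_hom X G Y H \<tau> \<longrightarrow>
        compose X (ars_unit Y H) \<tau> =
        compose X (ars_map (mr_of_ARS Y H) (mr_of_ARS X G) (mr_map X H \<tau>)) (ars_unit X G)) \<and>
   \<comment> \<open>natural isomorphism Id_MR = (composite)\<close>
   (\<forall>(R::'r mring). real_reduced R \<longrightarrow>
        mr_iso R (mr_of_ARS (ARS_pts R) (ARS_fns R)) (mr_unit R)) \<and>
   (\<forall>(R::'r mring) (S::'s mring) f. real_reduced R \<and> real_reduced S \<and> mr_hom R S f \<longrightarrow>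
        compose (mcar R) (mr_unit S) f =
        compose (mcar R) (mr_map (ARS_pts S) (ARS_fns R) (ars_map R S f)) (mr_unit R))"
proof (intro conjI allI impI; (elim conjE)?)
  fix X :: "'x set" and G assume X: "ARS X G"
  show "real_reduced (mr_of_ARS X G)" by (rule real_reduced_mr_of_ARS[OF X])
  show "mr_map X G (restrict id X) = restrict id G" by (rule mr_map_id[OF X])
  show "ars_iso X G (ARS_pts (mr_of_ARS X G)) (ARS_fns (mr_of_ARS X G)) (ars_unit X G)"
    by (rule ars_unit_iso[OF X])
next
  fix R :: "'r mring" assume "real_reduced R"
  then interpret real_reduced_multiring R by unfold_locales
  show "ARS (ARS_pts R) (ARS_fns R)" by (rule ARS_ARS_pts)
  show "ars_map R R (restrict id (mcar R)) = restrict id (ARS_pts R)" by (rule ars_map_id)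
  show "mr_iso R (mr_of_ARS (ARS_pts R) (ARS_fns R)) (mr_unit R)" by (rule mr_unit_iso)
qed (auto simp: real_reduced_def intro: mr_map_hom mr_map_compose ars_map_hom ars_map_compose
  ars_unit_natural mr_unit_natural)

end
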